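(* Let $d\ge2$, $\nu\in\mathbb{R}^d$, $\Sigma$ a symmetric positive definite $d\times d$ matrix, and let $\phi:[0,\infty)\to(0,\infty)$ be twice differentiable with $\phi'$ nowhere zero and such that the elliptical distribution $E_d(\nu,\Sigma,\phi)$ is well defined with finite mean. For $x\in\mathbb{R}^d$ put $t=\tfrac12(x-\nu)^T\Sigma^{-1}(x-\nu)$. Then for every real $\delta\ne2$, the matrix-valued function $$\boldsymbol{\tau}_\delta(x)=\frac{\frac{\phi''(t)/\phi'(t)}{\phi'(t)/\phi(t)}-\delta}{(2-\delta)(d-1)}\left(\left(\frac{d-1}{\delta\frac{\phi'(t)}{\phi(t)}-\frac{\phi''(t)}{\phi'(t)}}+2t\right)\Sigma-(x-\nu)(x-\nu)^T\right)$$ is a Stein kernel for $E_d(\nu,\Sigma,\phi)$, as long as $\boldsymbol{\tau}_\delta\in\mathrm{ACL}^1_{\mathrm{loc}}(\mathbb{R}^d)$ (entrywise). Here, at points where $\delta\phi'/\phi-\phi''/\phi'$ vanishes, the formula is understood after cancelling the common factor, i.e. as $$\frac{1}{(2-\delta)(d-1)}\Bigl(-(d-1)\tfrac{\phi(t)}{\phi'(t)}\Sigma+c(t)\bigl(2t\,\Sigma-(x-\nu)(x-\nu)^T\bigr)\Bigr),\qquad c=\tfrac{\phi''/\phi'}{\phi'/\phi}-\delta .$$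
   Context: $E_d(\nu,\Sigma,\phi)$ is the elliptical distribution on $\mathbb{R}^d$ with pdf $p(x)=\kappa\,[\det\Sigma]^{-1/2}\phi\bigl(\tfrac12(x-\nu)^T\Sigma^{-1}(x-\nu)\bigr)$, where $\kappa$ is the normalizing constant. It is assumed that $\phi(t)>0$ for all $t\ge0$, so that $\{p>0\}=\mathbb{R}^d$. $\mathrm{ACL}(\Omega)$ (for open $\Omega\subseteq\mathbb{R}^d$): Borel measurable $g:\Omega\to\mathbb{R}$ such that for each unit vector $e$ and almost all lines $L$ parallel to $e$ (with respect to $(d-1)$-dimensional Lebesgue measure), the restriction of $g$ to any compact interval contained in $\Omega\cap L$ is absolutely continuous. $\mathrm{ACL}^1(\Omega)$: $g\in\mathrm{ACL}(\Omega)$ with directional derivative $\partial_e g\in L^1(\Omega)$ for all unit vectors $e$. $\mathrm{ACL}^1_{\mathrm{loc}}(\Omega)$: $g$ such that each $x\in\Omega$ has an open neighbourhood $U\subseteq\Omega$ with $g|_U\in\mathrm{ACL}^1(U)$. For a pdf $p$ with finite mean $\nu$ and open support $\Omega_p=\{p>0\}$, a Stein kernel for $p$ is a $d\times d$ matrix-valued function $\boldsymbol{\tau}=(\tau_{ij})$ on $\Omega_p$ with $\tau_{ij}p\in\mathrm{ACL}^1_{\mathrm{loc}}(\Omega_p)$ for all $i,j$ and, for Lebesgue-almost all $x\in\Omega_p$ and all $i$, $\frac{1}{p(x)}\sum_{j=1}^d\partial_j(\tau_{ij}p)(x)=\nu_i-x_i$. *)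

theory Defs
  imports "HOL-Analysis.Analysis"
begin

definition abs_cont_on_interval :: "real \<Rightarrow> real \<Rightarrow> (real \<Rightarrow> real) \<Rightarrow> bool" where
  "abs_cont_on_interval a b f \<longleftrightarrow>
     (\<forall>\<epsilon>>0. \<exists>\<eta>>0. \<forall>(m::nat) u v.
        (\<forall>k<m. a \<le> u k \<and> u k \<le> v k \<and> v k \<le> b) \<longrightarrow>
        disjoint_family_on (\<lambda>k. {u k<..<v k}) {..<m} \<longrightarrow>
        (\<Sum>k<m. v k - u k) < \<eta> \<longrightarrow>
        (\<Sum>k<m. \<bar>f (v k) - f (u k)\<bar>) < \<epsilon>)"

definition orthonormal_basis_of_complement :: "'a::euclidean_space \<Rightarrow> 'a set \<Rightarrow> bool" where
  "orthonormal_basis_of_complement e B \<longleftrightarrow>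
     pairwise orthogonal B \<and> (\<forall>b\<in>B. norm b = 1) \<and> span B = {x. orthogonal e x}"

text \<open>
  Lines parallel to a unit vector \<open>e\<close> are indexed by their intersection with the hyperplane
  orthogonal to \<open>e\<close>. Lebesgue measure on that hyperplane is the image of the product measure
  \<open>\<Pi>\<^sub>M b\<in>B. lborel\<close> under the coordinate map of an orthonormal basis \<open>B\<close>. The null sets do not
  depend on \<open>B\<close>, so quantifying over all such \<open>B\<close> is the same as fixing one.
\<close>

definition ACL :: "'a::euclidean_space set \<Rightarrow> ('a \<Rightarrow> real) set" where
  "ACL \<Omega> = {g. g \<in> borel_measurable (restrict_space borel \<Omega>) \<and>
     (\<forall>e B. norm e = 1 \<longrightarrow> orthonormal_basis_of_complement e B \<longrightarrow>
        (AE c in (\<Pi>\<^sub>M b\<in>B. lborel).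
           let y = (\<Sum>b\<in>B. c b *\<^sub>R b) in
           \<forall>a b. a \<le> b \<longrightarrow> (\<forall>s\<in>{a..b}. y + s *\<^sub>R e \<in> \<Omega>) \<longrightarrow>
             abs_cont_on_interval a b (\<lambda>s. g (y + s *\<^sub>R e))))}"

definition dir_deriv :: "'a::euclidean_space \<Rightarrow> ('a \<Rightarrow> real) \<Rightarrow> 'a \<Rightarrow> real" where
  "dir_deriv e g x = deriv (\<lambda>s. g (x + s *\<^sub>R e)) 0"

text \<open>
  Since \<^const>\<open>deriv\<close> is total, the almost everywhere existence of the directional derivative,
  which is part of its being an element of \<open>L\<^sup>1(\<Omega>)\<close> (and is automatic for functions in
  \<open>ACL(\<Omega>)\<close> by Lebesgue's theorem), is written out.
\<close>

definition ACL1 :: "'a::euclidean_space set \<Rightarrow> ('a \<Rightarrow> real) set" where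
  "ACL1 \<Omega> = {g \<in> ACL \<Omega>. \<forall>e. norm e = 1 \<longrightarrow>
     (AE x in lebesgue. x \<in> \<Omega> \<longrightarrow> (\<lambda>s. g (x + s *\<^sub>R e)) differentiable (at 0)) \<and>
     set_integrable lebesgue \<Omega> (dir_deriv e g)}"

definition ACL1_loc :: "'a::euclidean_space set \<Rightarrow> ('a \<Rightarrow> real) set" where
  "ACL1_loc \<Omega> = {g. \<forall>x\<in>\<Omega>. \<exists>U. open U \<and> x \<in> U \<and> U \<subseteq> \<Omega> \<and> g \<in> ACL1 U}"


definition is_pdf :: "('a::euclidean_space \<Rightarrow> real) \<Rightarrow> bool" where
  "is_pdf p \<longleftrightarrow> (\<forall>x. 0 \<le> p x) \<and> has_bochner_integral lborel p 1"

definition has_finite_mean :: "('a::euclidean_space \<Rightarrow> real) \<Rightarrow> bool" where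
  "has_finite_mean p \<longleftrightarrow> integrable lborel (\<lambda>x. p x *\<^sub>R x)"

definition pdf_mean :: "('a::euclidean_space \<Rightarrow> real) \<Rightarrow> 'a" where
  "pdf_mean p = (\<integral>x. p x *\<^sub>R x \<partial>lborel)"

definition pdf_support :: "('a::euclidean_space \<Rightarrow> real) \<Rightarrow> 'a set" where
  "pdf_support p = {x. p x > 0}"

definition is_stein_kernel ::
  "(real^'n \<Rightarrow> real) \<Rightarrow> (real^'n \<Rightarrow> real^'n^'n) \<Rightarrow> bool" where
  "is_stein_kernel p \<tau> \<longleftrightarrow>
     is_pdf p \<and> has_finite_mean p \<and> open (pdf_support p) \<and>
     (\<forall>i j. (\<lambda>x. \<tau> x $ i $ j * p x) \<in> ACL1_loc (pdf_support p)) \<and>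
     (AE x in lebesgue. x \<in> pdf_support p \<longrightarrow>
        (\<forall>i. 1 / p x * (\<Sum>j\<in>UNIV. dir_deriv (axis j 1) (\<lambda>y. \<tau> y $ i $ j * p y) x)
               = pdf_mean p $ i - x $ i))"


definition sym_pos_def :: "real^'n^'n \<Rightarrow> bool" where
  "sym_pos_def A \<longleftrightarrow> transpose A = A \<and> (\<forall>x. x \<noteq> 0 \<longrightarrow> 0 < x \<bullet> (A *v x))"

definition half_quad :: "real^'n \<Rightarrow> real^'n^'n \<Rightarrow> real^'n \<Rightarrow> real" where
  "half_quad \<nu> \<Sigma> x = 1/2 * ((x - \<nu>) \<bullet> (matrix_inv \<Sigma> *v (x - \<nu>)))"

definition elliptical_unnormalized ::
  "real^'n \<Rightarrow> real^'n^'n \<Rightarrow> (real \<Rightarrow> real) \<Rightarrow> real^'n \<Rightarrow> real" where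
  "elliptical_unnormalized \<nu> \<Sigma> \<phi> x = det \<Sigma> powr (-1/2) * \<phi> (half_quad \<nu> \<Sigma> x)"

text \<open>
  The factor in front is the normalizing constant \<open>\<kappa>\<close>. If the integral diverges, the Bochner
  integral and hence \<open>elliptical_pdf\<close> are \<open>0\<close>; thus \<open>is_pdf (elliptical_pdf \<nu> \<Sigma> \<phi>)\<close> expresses
  that the distribution is well defined.
\<close>

definition elliptical_pdf ::
  "real^'n \<Rightarrow> real^'n^'n \<Rightarrow> (real \<Rightarrow> real) \<Rightarrow> real^'n \<Rightarrow> real" where
  "elliptical_pdf \<nu> \<Sigma> \<phi> x =
     1 / (\<integral>y. elliptical_unnormalized \<nu> \<Sigma> \<phi> y \<partial>lborel) * elliptical_unnormalized \<nu> \<Sigma> \<phi> x"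

definition outer :: "real^'n \<Rightarrow> real^'n^'n" where
  "outer v = (\<chi> i j. v $ i * v $ j)"

text \<open>
  \<open>\<phi>1\<close> and \<open>\<phi>2\<close> stand for the first and second derivative of \<open>\<phi>\<close>. The second branch is the
  displayed formula after cancelling the common factor.
\<close>

definition tau_delta ::
  "real^'n \<Rightarrow> real^'n^'n \<Rightarrow> (real \<Rightarrow> real) \<Rightarrow> (real \<Rightarrow> real) \<Rightarrow> (real \<Rightarrow> real) \<Rightarrow> real
    \<Rightarrow> real^'n \<Rightarrow> real^'n^'n" where
  "tau_delta \<nu> \<Sigma> \<phi> \<phi>1 \<phi>2 \<delta> x =
     (let t = half_quad \<nu> \<Sigma> x;
          d = real CARD('n);
          c = (\<phi>2 t / \<phi>1 t) / (\<phi>1 t / \<phi> t) - \<delta>;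
          r = \<delta> * (\<phi>1 t / \<phi> t) - \<phi>2 t / \<phi>1 t
      in if r \<noteq> 0
         then (c / ((2 - \<delta>) * (d - 1))) *\<^sub>R
                (((d - 1) / r + 2 * t) *\<^sub>R \<Sigma> - outer (x - \<nu>))
         else (1 / ((2 - \<delta>) * (d - 1))) *\<^sub>R
                ((- (d - 1) * (\<phi> t / \<phi>1 t)) *\<^sub>R \<Sigma>
                  + c *\<^sub>R ((2 * t) *\<^sub>R \<Sigma> - outer (x - \<nu>))))"

end

theory Submission
  imports Defs
begin

text \<open>
  With \<open>\<psi> = \<phi> / \<phi>'\<close> and \<open>c = 1 - \<delta> - \<psi>'\<close> the kernel is a multiple of \<open>-(d - 1) \<psi>(t) \<Sigma> + c(t) q\<close>, where
  \<open>q = 2 t \<Sigma> - (x - \<nu>)(x - \<nu>)\<^sup>T\<close>. The rows of \<open>q\<close> are orthogonal to the gradient of \<open>t\<close>, so the Stein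
  equation is an algebraic identity wherever \<open>c\<close> is differentiable at \<open>t(x)\<close>. This holds almost
  everywhere: a line parallel to an axis that is transversal to the level set of \<open>t\<close> at \<open>x\<close> makes \<open>t\<close> a
  local coordinate, and differentiability of \<open>\<tau>\<^sub>k\<^sub>k\<close> along it passes to \<open>c\<close> unless \<open>q\<^sub>k\<^sub>k = 0\<close>.

  For the regularity of \<open>\<tau> p\<close>, the term \<open>\<tau> \<partial>p\<close> of the product rule requires \<open>\<tau>\<close> to be locally
  integrable, which is not part of the hypothesis. Absolute continuity on almost all lines makes \<open>c\<close>
  continuous on \<open>(0, \<infinity>)\<close>, so \<open>\<tau>\<close> is continuous off \<open>\<nu>\<close>. Near \<open>\<nu>\<close> take a box: on almost every
  axis-parallel line \<open>\<tau>\<close> is bounded by its value on a face, where it is continuous, plus the integral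
  of \<open>\<bar>\<partial>\<tau>\<bar>\<close> along the line, and Fubini applies.
\<close>

section \<open>Absolutely continuous functions\<close>

lemma abs_cont_imp_continuous_on:
  assumes "abs_cont_on_interval a b f"
  shows "continuous_on {a..b} f"
proof -
  have "\<exists>d>0. \<forall>x'\<in>{a..b}. dist x' x < d \<longrightarrow> dist (f x') (f x) < e"
    if x: "x \<in> {a..b}" and e: "e > 0" for x e
  proof -
    obtain \<eta> where \<eta>: "\<eta> > 0"
      "\<And>(m::nat) u v. (\<forall>k<m. a \<le> u k \<and> u k \<le> v k \<and> v k \<le> b) \<Longrightarrow>
        disjoint_family_on (\<lambda>k. {u k<..<v k}) {..<m} \<Longrightarrow>
        (\<Sum>k<m. v k - u k) < \<eta> \<Longrightarrow> (\<Sum>k<m. \<bar>f (v k) - f (u k)\<bar>) < e"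
      using assms e unfolding abs_cont_on_interval_def by meson
    have "dist (f x') (f x) < e" if x': "x' \<in> {a..b}" "dist x' x < \<eta>" for x'
    proof -
      have "(\<Sum>k<Suc 0. \<bar>f (max x x') - f (min x x')\<bar>) < e"
        by (rule \<eta>(2)[of "Suc 0" "\<lambda>_. min x x'" "\<lambda>_. max x x'"])
          (use x x' in \<open>auto simp: disjoint_family_on_def dist_real_def max_def min_def\<close>)
      then show ?thesis
        by (auto simp: dist_real_def max_def min_def abs_minus_commute split: if_splits)
    qed
    then show ?thesis using \<eta>(1) by blast
  qed
  then show ?thesis unfolding continuous_on_iff by blast
qed

text \<open>Enumerating \<open>I\<close> by a bijection with an initial segment of the naturals
  frees the definition from its index type. The intended index set is a tagged division, whose
  elements are pairs of a tag and an interval.\<close>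

lemma abs_cont_finite_family:
  assumes "abs_cont_on_interval a b f" and "\<epsilon> > 0"
  shows "\<exists>\<eta>>0. \<forall>I u v. finite I \<longrightarrow> (\<forall>i\<in>I. a \<le> u i \<and> u i \<le> v i \<and> v i \<le> b) \<longrightarrow>
      disjoint_family_on (\<lambda>i. {u i<..<v i}) I \<longrightarrow> (\<Sum>i\<in>I. v i - u i) < \<eta> \<longrightarrow>
      (\<Sum>i\<in>I. \<bar>f (v i) - f (u i)\<bar>) < \<epsilon>"
proof -
  obtain \<eta> where \<eta>: "\<eta> > 0"
    "\<And>(m::nat) u v. (\<forall>k<m. a \<le> u k \<and> u k \<le> v k \<and> v k \<le> b) \<Longrightarrow>
      disjoint_family_on (\<lambda>k. {u k<..<v k}) {..<m} \<Longrightarrow>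
      (\<Sum>k<m. v k - u k) < \<eta> \<Longrightarrow> (\<Sum>k<m. \<bar>f (v k) - f (u k)\<bar>) < \<epsilon>"
    using assms unfolding abs_cont_on_interval_def by meson
  have "(\<Sum>i\<in>I. \<bar>f (v i) - f (u i)\<bar>) < \<epsilon>"
    if "finite I" and uv: "\<forall>i\<in>I. a \<le> u i \<and> u i \<le> v i \<and> v i \<le> b"
      and disj: "disjoint_family_on (\<lambda>i. {u i<..<v i}) I" and len: "(\<Sum>i\<in>I. v i - u i) < \<eta>"
    for I :: "'b set" and u v
  proof -
    obtain h where h: "bij_betw h {..<card I} I"
      using ex_bij_betw_nat_finite[OF \<open>finite I\<close>] by (auto simp: atLeast0LessThan)
    have hI: "h k \<in> I" if "k < card I" for k
      using h that by (auto simp: bij_betw_def)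
    have "(\<Sum>k<card I. \<bar>f (v (h k)) - f (u (h k))\<bar>) < \<epsilon>"
    proof (rule \<eta>(2))
      show "\<forall>k<card I. a \<le> u (h k) \<and> u (h k) \<le> v (h k) \<and> v (h k) \<le> b"
        using uv hI by blast
      show "disjoint_family_on (\<lambda>k. {u (h k)<..<v (h k)}) {..<card I}"
        unfolding disjoint_family_on_def
      proof (intro ballI impI)
        fix m n assume mn: "m \<in> {..<card I}" "n \<in> {..<card I}" "m \<noteq> n"
        then have "h m \<noteq> h n" using h by (auto simp: bij_betw_def inj_on_def)
        then show "{u (h m)<..<v (h m)} \<inter> {u (h n)<..<v (h n)} = {}"
          using disj hI mn unfolding disjoint_family_on_def by blast
      qed
      show "(\<Sum>k<card I. v (h k) - u (h k)) < \<eta>"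
        using len sum.reindex_bij_betw[OF h, of "\<lambda>i. v i - u i"] by simp
    qed
    then show ?thesis
      using sum.reindex_bij_betw[OF h, of "\<lambda>i. \<bar>f (v i) - f (u i)\<bar>"] by simp
  qed
  then show ?thesis using \<eta>(1) by (intro exI[of _ \<eta>] conjI allI impI)
qed

lemma abs_cont_on_interval_mult:
  assumes f: "abs_cont_on_interval a b f" and g: "abs_cont_on_interval a b g"
  shows "abs_cont_on_interval a b (\<lambda>s. f s * g s)"
  unfolding abs_cont_on_interval_def
proof (intro allI impI)
  fix \<epsilon> :: real assume "\<epsilon> > 0"
  have "bounded (f ` {a..b})" "bounded (g ` {a..b})"
    using abs_cont_imp_continuous_on[OF f] abs_cont_imp_continuous_on[OF g]
    by (auto intro!: compact_imp_bounded compact_continuous_image)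
  then obtain M N where M: "\<And>s. s \<in> {a..b} \<Longrightarrow> \<bar>f s\<bar> \<le> M" "M > 0"
    and N: "\<And>s. s \<in> {a..b} \<Longrightarrow> \<bar>g s\<bar> \<le> N" "N > 0"
    unfolding bounded_pos real_norm_def by (metis imageI)
  \<comment> \<open>The bounds are calibrated so that
    \<open>M * e2 + N * e1 = \<epsilon>\<close>.\<close>
  define e1 where "e1 = \<epsilon> / (2 * N)"
  define e2 where "e2 = \<epsilon> / (2 * M)"
  have e12: "e1 > 0" "e2 > 0" using \<open>\<epsilon> > 0\<close> M N by (auto simp: e1_def e2_def)
  obtain d1 where d1: "d1 > 0"
    "\<And>(m::nat) u v. (\<forall>k<m. a \<le> u k \<and> u k \<le> v k \<and> v k \<le> b) \<Longrightarrow>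
      disjoint_family_on (\<lambda>k. {u k<..<v k}) {..<m} \<Longrightarrow>
      (\<Sum>k<m. v k - u k) < d1 \<Longrightarrow> (\<Sum>k<m. \<bar>f (v k) - f (u k)\<bar>) < e1"
    using f e12 unfolding abs_cont_on_interval_def by meson
  obtain d2 where d2: "d2 > 0"
    "\<And>(m::nat) u v. (\<forall>k<m. a \<le> u k \<and> u k \<le> v k \<and> v k \<le> b) \<Longrightarrow>
      disjoint_family_on (\<lambda>k. {u k<..<v k}) {..<m} \<Longrightarrow>
      (\<Sum>k<m. v k - u k) < d2 \<Longrightarrow> (\<Sum>k<m. \<bar>g (v k) - g (u k)\<bar>) < e2"
    using g e12 unfolding abs_cont_on_interval_def by meson
  have "(\<Sum>k<m. \<bar>f (v k) * g (v k) - f (u k) * g (u k)\<bar>) < \<epsilon>"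
    if uv: "\<forall>k<m. a \<le> u k \<and> u k \<le> v k \<and> v k \<le> b"
      and disj: "disjoint_family_on (\<lambda>k. {u k<..<v k}) {..<m}"
      and len: "(\<Sum>k<m. v k - u k) < min d1 d2" for m :: nat and u v
  proof -
    have "\<bar>f (v k) * g (v k) - f (u k) * g (u k)\<bar> \<le>
        M * \<bar>g (v k) - g (u k)\<bar> + N * \<bar>f (v k) - f (u k)\<bar>" if "k < m" for k
    proof -
      have "f (v k) * g (v k) - f (u k) * g (u k)
          = f (v k) * (g (v k) - g (u k)) + g (u k) * (f (v k) - f (u k))"
        by (simp add: algebra_simps)
      also have "\<bar>\<dots>\<bar> \<le> \<bar>f (v k)\<bar> * \<bar>g (v k) - g (u k)\<bar> + \<bar>g (u k)\<bar> * \<bar>f (v k) - f (u k)\<bar>"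
        by (metis abs_mult abs_triangle_ineq)
      also have "\<dots> \<le> M * \<bar>g (v k) - g (u k)\<bar> + N * \<bar>f (v k) - f (u k)\<bar>"
      proof -
        have "v k \<in> {a..b}" "u k \<in> {a..b}" using uv that by force+
        then show ?thesis using M N by (intro add_mono mult_right_mono) auto
      qed
      finally show ?thesis .
    qed
    then have "(\<Sum>k<m. \<bar>f (v k) * g (v k) - f (u k) * g (u k)\<bar>) \<le>
        (\<Sum>k<m. M * \<bar>g (v k) - g (u k)\<bar> + N * \<bar>f (v k) - f (u k)\<bar>)"
      by (intro sum_mono) auto
    also have "\<dots> = M * (\<Sum>k<m. \<bar>g (v k) - g (u k)\<bar>) + N * (\<Sum>k<m. \<bar>f (v k) - f (u k)\<bar>)"
      by (simp add: sum.distrib sum_distrib_left)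
    also have "\<dots> < M * e2 + N * e1"
      using d1(2)[OF uv disj] d2(2)[OF uv disj] len M(2) N(2)
      by (intro add_strict_mono mult_strict_left_mono) auto
    also have "\<dots> = \<epsilon>" using M(2) N(2) by (simp add: e1_def e2_def)
    finally show ?thesis .
  qed
  then show "\<exists>\<eta>>0. \<forall>m u v. (\<forall>k<m. a \<le> u k \<and> u k \<le> v k \<and> v k \<le> b) \<longrightarrow>
        disjoint_family_on (\<lambda>k. {u k<..<v k}) {..<(m::nat)} \<longrightarrow>
        (\<Sum>k<m. v k - u k) < \<eta> \<longrightarrow>
        (\<Sum>k<m. \<bar>f (v k) * g (v k) - f (u k) * g (u k)\<bar>) < \<epsilon>"
    using d1(1) d2(1) by (intro exI[of _ "min d1 d2"]) auto
qed

lemma abs_cont_on_interval_lipschitz: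
  fixes f :: "real \<Rightarrow> real"
  assumes "\<And>s t. s \<in> {a..b} \<Longrightarrow> t \<in> {a..b} \<Longrightarrow> \<bar>f s - f t\<bar> \<le> L * \<bar>s - t\<bar>"
  shows "abs_cont_on_interval a b f"
  unfolding abs_cont_on_interval_def
proof (intro allI impI)
  fix \<epsilon> :: real assume "\<epsilon> > 0"
  \<comment> \<open>\<open>\<bar>L\<bar> + 1\<close> replaces \<open>L\<close> because it is
    positive whatever \<open>L\<close> is.\<close>
  have "(\<Sum>k<m. \<bar>f (v k) - f (u k)\<bar>) < \<epsilon>"
    if uv: "\<forall>k<m. a \<le> u k \<and> u k \<le> v k \<and> v k \<le> b"
      and len: "(\<Sum>k<m. v k - u k) < \<epsilon> / (\<bar>L\<bar> + 1)" for m :: nat and u v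
  proof -
    have "\<bar>f (v k) - f (u k)\<bar> \<le> (\<bar>L\<bar> + 1) * (v k - u k)" if "k < m" for k
    proof -
      have m: "a \<le> u k" "u k \<le> v k" "v k \<le> b" using uv that by auto
      have "\<bar>f (v k) - f (u k)\<bar> \<le> L * \<bar>v k - u k\<bar>" using m by (intro assms) auto
      also have "\<dots> \<le> (\<bar>L\<bar> + 1) * (v k - u k)" using m by (auto intro!: mult_mono)
      finally show ?thesis .
    qed
    then have "(\<Sum>k<m. \<bar>f (v k) - f (u k)\<bar>) \<le> (\<bar>L\<bar> + 1) * (\<Sum>k<m. v k - u k)"
      by (auto simp: sum_distrib_left intro!: sum_mono)
    also have "\<dots> < \<epsilon>" using len by (simp add: pos_less_divide_eq mult.commute)
    finally show ?thesis .
  qed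
  then show "\<exists>\<eta>>0. \<forall>m u v. (\<forall>k<m. a \<le> u k \<and> u k \<le> v k \<and> v k \<le> b) \<longrightarrow>
        disjoint_family_on (\<lambda>k. {u k<..<v k}) {..<(m::nat)} \<longrightarrow>
        (\<Sum>k<m. v k - u k) < \<eta> \<longrightarrow> (\<Sum>k<m. \<bar>f (v k) - f (u k)\<bar>) < \<epsilon>"
    using \<open>\<epsilon> > 0\<close> by (intro exI[of _ "\<epsilon> / (\<bar>L\<bar> + 1)"]) auto
qed

text \<open>The fundamental theorem of calculus in Henstock-Kurzweil form. In a fine tagged
  division, the intervals with tag in \<open>N\<close> have small total length, so absolute
  continuity makes the increments of \<open>f\<close> over them small. Over the other intervals the
  increments are compared with \<open>f'\<close> at the tag, with an error proportional to the
  length.\<close>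

lemma abs_cont_has_integral_deriv:
  fixes f f' :: "real \<Rightarrow> real"
  assumes "a \<le> b" and ac: "abs_cont_on_interval a b f" and N: "negligible N"
    and deriv: "\<And>x. x \<in> {a..b} - N \<Longrightarrow> (f has_real_derivative f' x) (at x within {a..b})"
  shows "(f' has_integral f b - f a) {a..b}"
proof -
  \<comment> \<open>With the value 0 on \<open>N\<close>, tags in \<open>N\<close> contribute only
    increments of \<open>f\<close> to the difference between the Riemann sum and
    \<open>f b - f a\<close>.\<close>
  define F where "F = (\<lambda>x. if x \<in> N then 0 else f' x)"
  have "(F has_integral f b - f a) {a..b}"
    unfolding has_integral_real
  proof (intro allI impI)
    fix e :: real assume "e > 0"
    \<comment> \<open>Chosen so that \<open>e' * (b - a)\<close> is at most \<open>e / 2\<close>;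
      the summand 1 covers \<open>a = b\<close>.\<close>
    define e' where "e' = e / (2 * (b - a + 1))"
    have "e' > 0" using \<open>e > 0\<close> \<open>a \<le> b\<close> by (simp add: e'_def)
    obtain \<eta> where \<eta>: "\<eta> > 0"
      "\<forall>(I :: (real \<times> real set) set) u v. finite I \<longrightarrow> (\<forall>i\<in>I. a \<le> u i \<and> u i \<le> v i \<and> v i \<le> b) \<longrightarrow>
        disjoint_family_on (\<lambda>i. {u i<..<v i}) I \<longrightarrow> (\<Sum>i\<in>I. v i - u i) < \<eta> \<longrightarrow>
        (\<Sum>i\<in>I. \<bar>f (v i) - f (u i)\<bar>) < e / 2"
      using abs_cont_finite_family[OF ac half_gt_zero[OF \<open>e > 0\<close>], where 'a="real \<times> real set"]
      by (elim exE conjE) (rule that)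
    \<comment> \<open>The indicator of a null set has integral 0. Its Riemann sum is the total
      length of the intervals tagged in \<open>N\<close>, so a suitable gauge pushes that length
      below \<open>\<eta>\<close>.\<close>
    have "((indicator N :: real \<Rightarrow> real) has_integral 0) {a..b}"
      using N by (simp add: negligible_def flip: box_real)
    then obtain \<gamma>1 where \<gamma>1: "gauge \<gamma>1"
      "\<And>p. p tagged_division_of {a..b} \<Longrightarrow> \<gamma>1 fine p \<Longrightarrow>
        norm ((\<Sum>(x,k)\<in>p. measure lborel k *\<^sub>R (indicator N x :: real)) - 0) < \<eta>"
      using \<eta>(1) unfolding has_integral_real by metis
    have "\<exists>d>0. \<forall>y\<in>{a..b}. \<bar>y - x\<bar> < d \<longrightarrow> \<bar>f y - f x - f' x * (y - x)\<bar> \<le> e' * \<bar>y - x\<bar>"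
      if "x \<in> {a..b} - N" for x
      using deriv[OF that] \<open>e' > 0\<close>
      unfolding has_field_derivative_def has_derivative_within_alt by auto
    then obtain d where d: "\<And>x. x \<in> {a..b} - N \<Longrightarrow> d x > 0"
      "\<And>x y. x \<in> {a..b} - N \<Longrightarrow> y \<in> {a..b} \<Longrightarrow> \<bar>y - x\<bar> < d x \<Longrightarrow>
        \<bar>f y - f x - f' x * (y - x)\<bar> \<le> e' * \<bar>y - x\<bar>"
      by metis
    \<comment> \<open>On this gauge an interval with tag \<open>x\<close> outside \<open>N\<close>
      stays in the range where \<open>f\<close> is linear up to slope error
      \<open>e'\<close>.\<close>
    define \<gamma>2 where "\<gamma>2 x = (if x \<in> {a..b} - N then ball x (d x) else UNIV)" for x
    have "gauge \<gamma>2" using d(1) by (auto simp: gauge_def \<gamma>2_def)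
    have "norm ((\<Sum>(x,k)\<in>p. measure lborel k *\<^sub>R F x) - (f b - f a)) < e"
      if p: "p tagged_division_of {a..b}" and fine: "(\<lambda>x. \<gamma>1 x \<inter> \<gamma>2 x) fine p" for p
    proof -
      have p': "finite p" "\<And>x k. (x,k) \<in> p \<Longrightarrow> x \<in> k" "\<And>x k. (x,k) \<in> p \<Longrightarrow> k \<subseteq> {a..b}"
        "\<And>x k. (x,k) \<in> p \<Longrightarrow> \<exists>u v. k = {u..v}"
        "\<And>x1 k1 x2 k2. (x1,k1) \<in> p \<Longrightarrow> (x2,k2) \<in> p \<Longrightarrow> (x1,k1) \<noteq> (x2,k2) \<Longrightarrow>
          interior k1 \<inter> interior k2 = {}"
        using tagged_division_ofD[OF p] by (auto simp: box_real)
      have pI: "\<exists>u v. k = {u..v} \<and> a \<le> u \<and> u \<le> x \<and> x \<le> v \<and> v \<le> b" if "(x,k) \<in> p" for x k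
        using p'(2-4)[OF that] by fastforce
      have uv: "a \<le> Inf k \<and> Inf k \<le> x \<and> x \<le> Sup k \<and> Sup k \<le> b \<and> k = {Inf k..Sup k}
          \<and> measure lborel k = Sup k - Inf k" if "(x,k) \<in> p" for x k
        using pI[OF that] by auto
      define A where "A = {z \<in> p. fst z \<in> N}"
      define G where "G = (\<lambda>(x,k). measure lborel k *\<^sub>R F x - (f (Sup k) - f (Inf k)))"
      have "(\<Sum>(x,k)\<in>p. measure lborel k *\<^sub>R F x) - (f b - f a) = sum G p"
        using additive_tagged_division_1[OF \<open>a \<le> b\<close> p, of f]
        by (simp add: G_def sum_subtractf split_beta)
      also have "\<bar>sum G p\<bar> \<le> \<bar>sum G A\<bar> + \<bar>sum G (p - A)\<bar>"
        using sum.subset_diff[of A p G] p'(1) by (simp add: A_def)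
      finally have le: "\<bar>(\<Sum>(x,k)\<in>p. measure lborel k *\<^sub>R F x) - (f b - f a)\<bar>
        \<le> \<bar>sum G A\<bar> + \<bar>sum G (p - A)\<bar>" .
      have "\<bar>sum G A\<bar> \<le> (\<Sum>z\<in>A. \<bar>G z\<bar>)" by (rule sum_abs)
      also have "\<dots> = (\<Sum>z\<in>A. \<bar>f (Sup (snd z)) - f (Inf (snd z))\<bar>)"
        by (intro sum.cong) (auto simp: G_def A_def F_def)
      also have "\<dots> < e / 2"
      proof (rule \<eta>(2)[rule_format])
        show "finite A" using p'(1) by (simp add: A_def)
        show "a \<le> Inf (snd z) \<and> Inf (snd z) \<le> Sup (snd z) \<and> Sup (snd z) \<le> b" if "z \<in> A" for z
          using uv[of "fst z" "snd z"] that by (auto simp: A_def)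
        show "disjoint_family_on (\<lambda>i. {Inf (snd i)<..<Sup (snd i)}) A"
          unfolding disjoint_family_on_def
        proof (intro ballI impI)
          fix z w assume zw: "z \<in> A" "w \<in> A" "z \<noteq> w"
          obtain x k y l where xy: "z = (x,k)" "w = (y,l)" by (metis surj_pair)
          have "interior k \<inter> interior l = {}" "k = {Inf k..Sup k}" "l = {Inf l..Sup l}"
            using p'(5)[of x k y l] uv zw xy by (auto simp: A_def)
          then show "{Inf (snd z)<..<Sup (snd z)} \<inter> {Inf (snd w)<..<Sup (snd w)} = {}"
            using xy by (metis interior_atLeastAtMost_real snd_conv)
        qed
        have "(\<Sum>i\<in>A. Sup (snd i) - Inf (snd i)) = (\<Sum>(x,k)\<in>p. measure lborel k *\<^sub>R (indicator N x :: real))"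
          unfolding A_def sum.inter_filter[OF p'(1)]
        proof (intro sum.cong refl)
          fix z assume "z \<in> p"
          then show "(if fst z \<in> N then Sup (snd z) - Inf (snd z) else 0)
              = (case z of (x,k) \<Rightarrow> measure lborel k *\<^sub>R (indicator N x :: real))"
            using uv[of "fst z" "snd z"] by (auto simp: indicator_def split_beta)
        qed
        moreover have "\<gamma>1 fine p" using fine by (auto simp: fine_def)
        ultimately show "(\<Sum>i\<in>A. Sup (snd i) - Inf (snd i)) < \<eta>"
          using \<gamma>1(2)[OF p] by simp
      qed
      finally have 1: "\<bar>sum G A\<bar> < e / 2" .
      have Gle: "\<bar>G z\<bar> \<le> e' * (Sup (snd z) - Inf (snd z))" if zp: "z \<in> p - A" for z
      proof -
        obtain x k where z: "z = (x,k)" by (metis surj_pair)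
        have xk: "(x,k) \<in> p" "x \<notin> N" using zp z by (auto simp: A_def)
        note u = uv[OF xk(1)]
        have xab: "x \<in> {a..b} - N" using u xk by auto
        have "k \<subseteq> \<gamma>2 x" using fineD[OF fine xk(1)] by auto
        then have "k \<subseteq> ball x (d x)" using xab by (simp only: \<gamma>2_def if_True)
        moreover have "Sup k \<in> k" "Inf k \<in> k" using u by (metis atLeastAtMost_iff order_trans order_refl)+
        ultimately have "\<bar>Sup k - x\<bar> < d x" "\<bar>Inf k - x\<bar> < d x"
          by (auto simp: dist_real_def abs_minus_commute subset_iff)
        then have "\<bar>f (Sup k) - f x - f' x * (Sup k - x)\<bar> \<le> e' * (Sup k - x)"
          "\<bar>f (Inf k) - f x - f' x * (Inf k - x)\<bar> \<le> e' * (x - Inf k)"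
          using d(2)[OF xab, of "Sup k"] d(2)[OF xab, of "Inf k"] u by auto
        \<comment> \<open>The tag lies between the endpoints, so the linearization errors at the two
          ends add up to at most \<open>e'\<close> times the length of the interval.\<close>
        moreover have "G z = (f (Inf k) - f x - f' x * (Inf k - x)) - (f (Sup k) - f x - f' x * (Sup k - x))"
        proof -
          have m: "measure lborel k = Sup k - Inf k" using u by blast
          show ?thesis using xk(2) unfolding z G_def F_def prod.case m by (simp add: algebra_simps)
        qed
        moreover have "e' * (Sup k - x) + e' * (x - Inf k) = e' * (Sup k - Inf k)"
          by (simp add: algebra_simps)
        ultimately show ?thesis by (simp add: z)
      qed
      have "\<bar>sum G (p - A)\<bar> \<le> (\<Sum>z\<in>p - A. \<bar>G z\<bar>)" by (rule sum_abs)
      also have "\<dots> \<le> (\<Sum>z\<in>p - A. e' * (Sup (snd z) - Inf (snd z)))" by (intro sum_mono Gle)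
      also have "\<dots> \<le> (\<Sum>z\<in>p. e' * (Sup (snd z) - Inf (snd z)))"
      proof (intro sum_mono2 p'(1) Diff_subset)
        fix z assume "z \<in> p - (p - A)"
        then have "Inf (snd z) \<le> Sup (snd z)" using uv[of "fst z" "snd z"] by auto
        then show "0 \<le> e' * (Sup (snd z) - Inf (snd z))" using \<open>e' > 0\<close> by simp
      qed
      also have "\<dots> = e' * (b - a)"
        using additive_tagged_division_1[OF \<open>a \<le> b\<close> p, of "\<lambda>x. x"]
        by (simp add: split_beta flip: sum_distrib_left)
      also have "\<dots> \<le> e / 2"
        using \<open>e > 0\<close> \<open>a \<le> b\<close> by (simp add: e'_def field_simps)
      finally show ?thesis using le 1 by simp
    qed
    then show "\<exists>\<gamma>. gauge \<gamma> \<and> (\<forall>p. p tagged_division_of {a..b} \<and> \<gamma> fine p \<longrightarrow>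
        norm ((\<Sum>(x,k)\<in>p. measure lborel k *\<^sub>R F x) - (f b - f a)) < e)"
      using gauge_Int[OF \<gamma>1(1) \<open>gauge \<gamma>2\<close>] by blast
  qed
  then show ?thesis
    by (rule has_integral_spike[OF N, rotated]) (auto simp: F_def)
qed

section \<open>Lines parallel to a coordinate axis\<close>

text \<open>Tonelli with the coordinate \<open>e\<close> integrated first. The outer variable
  parametrizes lines parallel to \<open>e\<close> in the same way as in the definition of
  \<open>ACL\<close>.\<close>

lemma nn_integral_lborel_split_axis:
  fixes e :: "'a::euclidean_space" and f :: "'a \<Rightarrow> ennreal"
  assumes e: "e \<in> Basis" and [measurable]: "f \<in> borel_measurable borel"
  shows "(\<integral>\<^sup>+x. f x \<partial>lborel) =
    (\<integral>\<^sup>+c. (\<integral>\<^sup>+s. f ((\<Sum>b\<in>Basis-{e}. c b *\<^sub>R b) + s *\<^sub>R e) \<partial>lborel) \<partial>(\<Pi>\<^sub>M b\<in>Basis-{e}. lborel))"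
proof -
  interpret product_sigma_finite "\<lambda>_::'a. lborel :: real measure"
    by (rule product_sigma_finite.intro) (rule sigma_finite_lborel)
  have B: "insert e (Basis - {e}) = (Basis :: 'a set)" using e by auto
  have "(\<integral>\<^sup>+x. f x \<partial>lborel) = (\<integral>\<^sup>+g. f (\<Sum>b\<in>Basis. g b *\<^sub>R b) \<partial>(\<Pi>\<^sub>M b\<in>Basis. lborel))"
    by (subst lborel_eq) (simp add: nn_integral_distr)
  also have "\<dots> = (\<integral>\<^sup>+g. f (\<Sum>b\<in>Basis. g b *\<^sub>R b) \<partial>(\<Pi>\<^sub>M b\<in>insert e (Basis-{e}). lborel))"
    by (simp only: B)
  also have "\<dots> = (\<integral>\<^sup>+c. (\<integral>\<^sup>+s. f (\<Sum>b\<in>Basis. (c(e := s)) b *\<^sub>R b) \<partial>lborel) \<partial>(\<Pi>\<^sub>M b\<in>Basis-{e}. lborel))"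
    by (rule product_nn_integral_insert) (simp_all add: B)
  also have "\<dots> = (\<integral>\<^sup>+c. (\<integral>\<^sup>+s. f ((\<Sum>b\<in>Basis-{e}. c b *\<^sub>R b) + s *\<^sub>R e) \<partial>lborel) \<partial>(\<Pi>\<^sub>M b\<in>Basis-{e}. lborel))"
  proof -
    have "(\<Sum>b\<in>Basis. (c(e := s)) b *\<^sub>R b) = (\<Sum>b\<in>Basis-{e}. c b *\<^sub>R b) + s *\<^sub>R e" for c s
      using e by (subst sum.remove[of _ e]) (auto intro!: sum.cong simp: add.commute)
    then show ?thesis by simp
  qed
  finally show ?thesis .
qed

lemma sum_Basis_remove_inner:
  fixes e :: "'a::euclidean_space"
  assumes "e \<in> Basis"
  shows "(\<Sum>b\<in>Basis-{e}. (x \<bullet> b) *\<^sub>R b) = x - (x \<bullet> e) *\<^sub>R e"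
  using sum.remove[OF finite_Basis assms, of "\<lambda>b. (x \<bullet> b) *\<^sub>R b"]
  by (simp add: euclidean_representation algebra_simps)

lemma inner_sum_Basis_remove:
  fixes e :: "'a::euclidean_space"
  assumes "e \<in> Basis" "b \<in> Basis"
  shows "((\<Sum>b\<in>Basis-{e}. c b *\<^sub>R b) + s *\<^sub>R e) \<bullet> b = (if b = e then s else c b)"
proof -
  have "(\<Sum>b\<in>Basis-{e}. c b *\<^sub>R b) + s *\<^sub>R e = (\<Sum>b\<in>Basis. (if b = e then s else c b) *\<^sub>R b)"
    using assms by (subst (2) sum.remove[of _ e]) (auto intro!: sum.cong)
  then show ?thesis using assms by simp
qed

text \<open>Lets the definition of \<open>ACL\<close>, which speaks of all orthonormal bases of the
  complement, be used with ordinary coordinates.\<close>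

lemma orthonormal_basis_of_complement_Basis:
  fixes e :: "'a::euclidean_space"
  assumes "e \<in> Basis"
  shows "orthonormal_basis_of_complement e (Basis - {e})"
  unfolding orthonormal_basis_of_complement_def
proof (intro conjI)
  show "pairwise orthogonal (Basis - {e})"
    using orthogonal_Basis by (rule pairwise_subset) auto
  show "span (Basis - {e}) = {x. orthogonal e x}"
  proof
    show "span (Basis - {e}) \<subseteq> {x. orthogonal e x}"
    proof (rule span_minimal)
      show "Basis - {e} \<subseteq> {x. orthogonal e x}"
        using assms by (auto simp: orthogonal_def inner_Basis)
    qed (rule subspace_orthogonal_to_vector)
    show "{x. orthogonal e x} \<subseteq> span (Basis - {e})"
    proof
      fix x assume "x \<in> {x. orthogonal e x}"
      then have "x = (\<Sum>b\<in>Basis-{e}. (x \<bullet> b) *\<^sub>R b)"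
        using sum_Basis_remove_inner[OF assms, of x] by (simp add: orthogonal_def inner_commute[of e x])
      also have "\<dots> \<in> span (Basis - {e})"
        by (intro span_sum span_scale span_base)
      finally show "x \<in> span (Basis - {e})" .
    qed
  qed
qed auto

text \<open>Passes from almost every line to almost every point: the exceptional points lie in the
  cylinder over a null set of the hyperplane, and such a cylinder is null by Tonelli.\<close>

lemma AE_lborel_axis:
  fixes e :: "'a::euclidean_space"
  assumes e: "e \<in> Basis" and P: "AE c in (\<Pi>\<^sub>M b\<in>Basis-{e}. lborel). P c"
  shows "AE x in lborel. P (restrict (\<lambda>b. x \<bullet> b) (Basis - {e}))"
proof -
  let ?M = "\<Pi>\<^sub>M b\<in>Basis-{e}. (lborel :: real measure)"
  obtain N where N: "{c \<in> space ?M. \<not> P c} \<subseteq> N" "emeasure ?M N = 0" "N \<in> sets ?M"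
    using P by (rule AE_E)
  define h where "h = (\<lambda>x::'a. restrict (\<lambda>b. x \<bullet> b) (Basis - {e}))"
  have [measurable]: "h \<in> borel \<rightarrow>\<^sub>M ?M" unfolding h_def by measurable
  have hsp: "h x \<in> space ?M" for x by (auto simp: h_def space_PiM)
  have hc: "h ((\<Sum>b\<in>Basis-{e}. c b *\<^sub>R b) + s *\<^sub>R e) = c" if "c \<in> space ?M" for c s
    using that inner_sum_Basis_remove[OF e, of _ c s]
    by (auto simp: h_def space_PiM PiE_def extensional_def restrict_def)
  have [measurable]: "N \<in> sets ?M" by fact
  have "emeasure lborel (h -` N) = (\<integral>\<^sup>+x. indicator N (h x) \<partial>lborel)"
    using measurable_sets[OF \<open>h \<in> borel \<rightarrow>\<^sub>M ?M\<close> N(3)]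
    by (simp flip: nn_integral_indicator indicator_vimage)
  also have "\<dots> = (\<integral>\<^sup>+c. (\<integral>\<^sup>+s. indicator N (h ((\<Sum>b\<in>Basis-{e}. c b *\<^sub>R b) + s *\<^sub>R e)) \<partial>lborel) \<partial>?M)"
    by (rule nn_integral_lborel_split_axis[OF e]) measurable
  also have "\<dots> = (\<integral>\<^sup>+c. (\<integral>\<^sup>+(s::real). indicator N c \<partial>lborel) \<partial>?M)"
    by (intro nn_integral_cong) (simp only: hc)
  \<comment> \<open>A line lies in the cylinder or misses it. In the first case its length is
    infinite, which does no harm over a null set of lines.\<close>
  also have "\<dots> = (\<integral>\<^sup>+c. \<infinity> * indicator N c \<partial>?M)"
    by (simp add: mult.commute)
  also have "\<dots> = 0" using N(2,3) by (simp add: nn_integral_cmult)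
  finally have "h -` N \<in> null_sets lborel"
    using measurable_sets[OF \<open>h \<in> borel \<rightarrow>\<^sub>M ?M\<close> N(3)] by (auto intro: null_setsI)
  then have "AE x in lborel. x \<notin> h -` N" by (rule AE_not_in)
  then show ?thesis
    by eventually_elim (use N(1) hsp in \<open>auto simp: h_def\<close>)
qed

lemma abs_cont_on_interval_shift:
  assumes "abs_cont_on_interval (a + r) (b + r) f"
  shows "abs_cont_on_interval a b (\<lambda>s. f (s + r))"
  unfolding abs_cont_on_interval_def
proof (intro allI impI)
  fix \<epsilon> :: real assume "\<epsilon> > 0"
  then obtain \<eta> where \<eta>: "\<eta> > 0"
    "\<And>(m::nat) u v. (\<forall>k<m. a + r \<le> u k \<and> u k \<le> v k \<and> v k \<le> b + r) \<Longrightarrow>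
      disjoint_family_on (\<lambda>k. {u k<..<v k}) {..<m} \<Longrightarrow>
      (\<Sum>k<m. v k - u k) < \<eta> \<Longrightarrow> (\<Sum>k<m. \<bar>f (v k) - f (u k)\<bar>) < \<epsilon>"
    using assms unfolding abs_cont_on_interval_def by meson
  have "(\<Sum>k<m. \<bar>f (v k + r) - f (u k + r)\<bar>) < \<epsilon>"
    if "\<forall>k<m. a \<le> u k \<and> u k \<le> v k \<and> v k \<le> b"
      and disj: "disjoint_family_on (\<lambda>k. {u k<..<v k}) {..<m}"
      and "(\<Sum>k<m. v k - u k) < \<eta>" for m :: nat and u v
  proof (rule \<eta>(2))
    show "disjoint_family_on (\<lambda>k. {u k + r<..<v k + r}) {..<m}"
      unfolding disjoint_family_on_def
    proof (intro ballI impI)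
      fix i j assume "i \<in> {..<m}" "j \<in> {..<m}" "i \<noteq> j"
      then have *: "{u i<..<v i} \<inter> {u j<..<v j} = {}" using disj by (simp add: disjoint_family_on_def)
      show "{u i + r<..<v i + r} \<inter> {u j + r<..<v j + r} = {}"
      proof (rule equals0I)
        fix x assume "x \<in> {u i + r<..<v i + r} \<inter> {u j + r<..<v j + r}"
        then have "x - r \<in> {u i<..<v i} \<inter> {u j<..<v j}" by auto
        with * show False by simp
      qed
    qed
  qed (use that in auto)
  then show "\<exists>\<eta>>0. \<forall>m u v. (\<forall>k<m. a \<le> u k \<and> u k \<le> v k \<and> v k \<le> b) \<longrightarrow>
        disjoint_family_on (\<lambda>k. {u k<..<v k}) {..<(m::nat)} \<longrightarrow>
        (\<Sum>k<m. v k - u k) < \<eta> \<longrightarrow> (\<Sum>k<m. \<bar>f (v k + r) - f (u k + r)\<bar>) < \<epsilon>"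
    using \<eta>(1) by (intro exI[of _ \<eta>]) auto
qed

text \<open>The line through \<open>x\<close> is the line through its projection to the hyperplane,
  with the parameter shifted by \<open>x \<bullet> e\<close>. Basing lines at points of the space
  allows a good line to be chosen through any nonempty open set.\<close>

lemma ACL_AE_abs_cont_on_axis_lines:
  fixes e :: "'a::euclidean_space"
  assumes g: "g \<in> ACL \<Omega>" and e: "e \<in> Basis"
  shows "AE x in lborel. \<forall>a b. a \<le> b \<longrightarrow> (\<forall>s\<in>{a..b}. x + s *\<^sub>R e \<in> \<Omega>) \<longrightarrow>
    abs_cont_on_interval a b (\<lambda>s. g (x + s *\<^sub>R e))"
proof -
  have "AE c in (\<Pi>\<^sub>M b\<in>Basis-{e}. lborel).
          let y = (\<Sum>b\<in>Basis-{e}. c b *\<^sub>R b) in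
           \<forall>a b. a \<le> b \<longrightarrow> (\<forall>s\<in>{a..b}. y + s *\<^sub>R e \<in> \<Omega>) \<longrightarrow>
             abs_cont_on_interval a b (\<lambda>s. g (y + s *\<^sub>R e))"
    using g orthonormal_basis_of_complement_Basis[OF e] e by (auto simp: ACL_def)
  from AE_lborel_axis[OF e this] show ?thesis
  proof (eventually_elim, intro allI impI)
    fix x a b
    define y where "y = x - (x \<bullet> e) *\<^sub>R e"
    have y: "(\<Sum>b\<in>Basis-{e}. restrict (\<lambda>b. x \<bullet> b) (Basis - {e}) b *\<^sub>R b) = y"
      using sum_Basis_remove_inner[OF e, of x] by (simp add: y_def)
    assume H: "let y = (\<Sum>b\<in>Basis-{e}. restrict (\<lambda>b. x \<bullet> b) (Basis - {e}) b *\<^sub>R b) in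
           \<forall>a b. a \<le> b \<longrightarrow> (\<forall>s\<in>{a..b}. y + s *\<^sub>R e \<in> \<Omega>) \<longrightarrow>
             abs_cont_on_interval a b (\<lambda>s. g (y + s *\<^sub>R e))"
      and "a \<le> b" and seg: "\<forall>s\<in>{a..b}. x + s *\<^sub>R e \<in> \<Omega>"
    have xy: "x + s *\<^sub>R e = y + (s + x \<bullet> e) *\<^sub>R e" for s by (simp add: y_def algebra_simps)
    have "\<forall>s\<in>{a + x \<bullet> e..b + x \<bullet> e}. y + s *\<^sub>R e \<in> \<Omega>"
    proof
      fix s assume "s \<in> {a + x \<bullet> e..b + x \<bullet> e}"
      then show "y + s *\<^sub>R e \<in> \<Omega>" using seg[rule_format, of "s - x \<bullet> e"] by (simp add: xy)
    qed
    then have "abs_cont_on_interval (a + x \<bullet> e) (b + x \<bullet> e) (\<lambda>s. g (y + s *\<^sub>R e))"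
      using H \<open>a \<le> b\<close> unfolding y Let_def by simp
    from abs_cont_on_interval_shift[OF this] show "abs_cont_on_interval a b (\<lambda>s. g (x + s *\<^sub>R e))"
      by (simp add: xy)
  qed
qed

text \<open>Membership in \<open>ACL1\<close> controls derivatives only. On almost every line, the
  value at a point of the box differs from the value at the upper face by at most the integral of
  the absolute derivative over the line. This majorant does not depend on the position on the line,
  so integrating it over the box costs only a factor, the edge length.\<close>

lemma ACL1_integrable_on_cbox:
  fixes g :: "'a::euclidean_space \<Rightarrow> real"
  assumes g: "g \<in> ACL1 U" and U: "cbox l u \<subseteq> U" "open U" and e: "e \<in> Basis"
    and face: "\<And>x. x \<in> cbox l u \<Longrightarrow> x \<bullet> e = u \<bullet> e \<Longrightarrow> \<bar>g x\<bar> \<le> M"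
  shows "set_integrable lebesgue (cbox l u) g"
proof -
  let ?M = "\<Pi>\<^sub>M b\<in>Basis-{e}. (lborel :: real measure)"
  let ?y = "\<lambda>c. (\<Sum>b\<in>Basis-{e}. c b *\<^sub>R b)"
  let ?Q = "cbox l u"
  interpret P: product_sigma_finite "\<lambda>_::'a. lborel :: real measure"
    by (rule product_sigma_finite.intro) (rule sigma_finite_lborel)
  interpret L: sigma_finite_measure "lborel :: real measure" by (rule sigma_finite_lborel)
  have norm_e: "norm e = 1" using e by simp
  define D where "D = dir_deriv e g"
  have "set_integrable lebesgue U D" and gACL: "g \<in> ACL U"
    and diff: "AE x in lebesgue. x \<in> U \<longrightarrow> (\<lambda>s. g (x + s *\<^sub>R e)) differentiable (at 0)"
    using g norm_e unfolding ACL1_def D_def by auto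
  then have Dint: "integrable lebesgue (\<lambda>x. indicator U x *\<^sub>R D x)"
    by (simp add: set_integrable_def)
  \<comment> \<open>The directional derivative is merely Lebesgue measurable, while the Tonelli
    splitting asks for a Borel function; \<open>h\<close> is a Borel representative.\<close>
  obtain h where h[measurable]: "h \<in> borel_measurable lborel"
    and hD: "AE x in lborel. indicator U x *\<^sub>R D x = h x"
    using completion_ex_borel_measurable_real[OF borel_measurable_integrable[OF Dint]] by blast
  have "integrable lebesgue h"
    by (rule integrable_cong_AE_imp[OF Dint]) (use h hD in \<open>auto intro: measurable_completion AE_completion\<close>)
  then have "integrable lborel h" using h by (simp add: integrable_completion)
  then have hfin: "(\<integral>\<^sup>+x. ennreal \<bar>h x\<bar> \<partial>lborel) < \<infinity>"
    by (simp add: integrable_iff_bounded)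
  have "AE x in lborel. x \<in> U \<longrightarrow> (\<lambda>s. g (x + s *\<^sub>R e)) differentiable (at 0) \<and> D x = h x"
    using hD diff[unfolded AE_completion_iff] by eventually_elim auto
  \<comment> \<open>One Borel null set collects the points where the derivative fails to exist or
    differs from \<open>h\<close>; almost every line meets it in a null set.\<close>
  then obtain N where N: "{x. \<not> (x \<in> U \<longrightarrow> (\<lambda>s. g (x + s *\<^sub>R e)) differentiable (at 0) \<and> D x = h x)} \<subseteq> N"
      "emeasure lborel N = 0" "N \<in> sets borel"
    by (rule AE_E) auto
  have [measurable]: "N \<in> sets borel" by fact
  have "(\<integral>\<^sup>+c. (\<integral>\<^sup>+s. indicator N (?y c + s *\<^sub>R e) \<partial>lborel) \<partial>?M) = 0"
    using N by (subst nn_integral_lborel_split_axis[OF e, symmetric]) auto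
  then have "AE c in ?M. (\<integral>\<^sup>+s. indicator N (?y c + s *\<^sub>R e) \<partial>lborel) = 0"
    by (subst (asm) nn_integral_0_iff_AE) auto
  then have AEN: "AE c in ?M. AE s in lborel. ?y c + s *\<^sub>R e \<notin> N"
  proof eventually_elim
    case (elim c)
    then have "AE s in lborel. indicator N (?y c + s *\<^sub>R e) = (0::ennreal)"
      by (subst (asm) nn_integral_0_iff_AE) auto
    then show ?case by eventually_elim (auto simp: indicator_eq_0_iff)
  qed
  have AEac: "AE c in ?M. let y = ?y c in
           \<forall>a b. a \<le> b \<longrightarrow> (\<forall>s\<in>{a..b}. y + s *\<^sub>R e \<in> U) \<longrightarrow>
             abs_cont_on_interval a b (\<lambda>s. g (y + s *\<^sub>R e))"
    using gACL orthonormal_basis_of_complement_Basis[OF e] e by (auto simp: ACL_def)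
  define a where "a = l \<bullet> e"
  define b where "b = u \<bullet> e"
  \<comment> \<open>Taken over the whole line, so that it depends on the line only. The value may be
    infinite, and the bound below is then trivial.\<close>
  define H where "H c = (\<integral>\<^sup>+r. ennreal \<bar>h (?y c + r *\<^sub>R e)\<bar> \<partial>lborel)" for c
  have H[measurable]: "H \<in> borel_measurable ?M" unfolding H_def by measurable
  have bound: "AE c in ?M. \<forall>s. indicator ?Q (?y c + s *\<^sub>R e) * ennreal \<bar>g (?y c + s *\<^sub>R e)\<bar>
      \<le> ennreal M * indicator ?Q (?y c + s *\<^sub>R e) + H c * indicator {a..b} s"
    using AEN AEac
  proof (eventually_elim, intro allI)
    fix c s
    define y where "y = ?y c"
    define f where "f = (\<lambda>s. g (y + s *\<^sub>R e))"
    assume AEs: "AE s in lborel. ?y c + s *\<^sub>R e \<notin> N"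
      and ac: "let y = ?y c in
           \<forall>a b. a \<le> b \<longrightarrow> (\<forall>s\<in>{a..b}. y + s *\<^sub>R e \<in> U) \<longrightarrow>
             abs_cont_on_interval a b (\<lambda>s. g (y + s *\<^sub>R e))"
    show "indicator ?Q (?y c + s *\<^sub>R e) * ennreal \<bar>g (?y c + s *\<^sub>R e)\<bar>
      \<le> ennreal M * indicator ?Q (?y c + s *\<^sub>R e) + H c * indicator {a..b} s"
    proof (cases "y + s *\<^sub>R e \<in> ?Q")
      case True
      then have bnd: "l \<bullet> i \<le> (if i = e then s else c i) \<and> (if i = e then s else c i) \<le> u \<bullet> i"
        if "i \<in> Basis" for i
        using inner_sum_Basis_remove[OF e that, of c s] that unfolding y_def mem_box by auto
      have sab: "s \<in> {a..b}" using bnd[OF e] by (simp add: a_def b_def)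
      have line: "y + r *\<^sub>R e \<in> ?Q" if "r \<in> {s..b}" for r
        unfolding mem_box
      proof
        fix i :: 'a assume "i \<in> Basis"
        then show "l \<bullet> i \<le> (y + r *\<^sub>R e) \<bullet> i \<and> (y + r *\<^sub>R e) \<bullet> i \<le> u \<bullet> i"
          using bnd[of i] that sab unfolding y_def inner_sum_Basis_remove[OF e \<open>i \<in> Basis\<close>]
          by (auto simp: a_def b_def split: if_splits)
      qed
      have fac: "abs_cont_on_interval s b f"
        unfolding f_def
      proof (rule ac[unfolded Let_def, folded y_def, rule_format])
        show "s \<le> b" using sab by simp
        show "y + r *\<^sub>R e \<in> U" if "r \<in> {s..b}" for r using line[OF that] U(1) by blast
      qed
      define Z where "Z = {r. y + r *\<^sub>R e \<in> N}"
      have "Z \<in> null_sets lborel"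
        using AEs N(3) by (intro AE_iff_null_sets[THEN iffD2]) (auto simp: Z_def y_def)
      then have Z: "negligible Z"
        by (simp add: negligible_iff_null_sets null_sets_completionI)
      have der: "(f has_real_derivative h (y + r *\<^sub>R e)) (at r within {s..b})" if "r \<in> {s..b} - Z" for r
      proof -
        have "y + r *\<^sub>R e \<in> U" "y + r *\<^sub>R e \<notin> N" using that line U(1) by (auto simp: Z_def)
        then have "(\<lambda>s. g (y + r *\<^sub>R e + s *\<^sub>R e)) differentiable (at 0)" "D (y + r *\<^sub>R e) = h (y + r *\<^sub>R e)"
          using N(1) by auto
        then have "((\<lambda>s. g (y + r *\<^sub>R e + s *\<^sub>R e)) has_real_derivative h (y + r *\<^sub>R e)) (at 0)"
          unfolding D_def dir_deriv_def by (simp add: DERIV_deriv_iff_real_differentiable[symmetric])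
        moreover have "(\<lambda>s. g (y + r *\<^sub>R e + s *\<^sub>R e)) = (\<lambda>s. f (r + s))"
          by (simp add: f_def algebra_simps)
        ultimately have "(f has_real_derivative h (y + r *\<^sub>R e)) (at r)"
          using DERIV_shift[of f "h (y + r *\<^sub>R e)" 0 r] by (simp add: add.commute)
        then show ?thesis by (rule DERIV_subset) simp
      qed
      have hi: "((\<lambda>r. h (y + r *\<^sub>R e)) has_integral f b - f s) {s..b}"
        using abs_cont_has_integral_deriv[OF _ fac Z der] sab by simp
      have "ennreal \<bar>f b - f s\<bar> \<le> H c"
      proof (cases "H c = \<infinity>")
        case False
        \<comment> \<open>For finite \<open>H c\<close> the function \<open>h\<close> is Lebesgue
          integrable on the line, so the Henstock-Kurzweil integral \<open>hi\<close> is a Lebesgue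
          integral and obeys the norm bound.\<close>
        have li: "integrable lborel (\<lambda>r. h (y + r *\<^sub>R e))"
          using False unfolding integrable_iff_bounded H_def y_def by (auto simp: less_top)
        then have si: "set_integrable lborel {s..b} (\<lambda>r. h (y + r *\<^sub>R e))"
          unfolding set_integrable_def by (intro integrable_mult_indicator) auto
        have "f b - f s = (LINT r:{s..b}|lborel. h (y + r *\<^sub>R e))"
          using set_borel_integral_eq_integral(2)[OF si] integral_unique[OF hi] by simp
        also have "ennreal \<bar>\<dots>\<bar> \<le> (\<integral>\<^sup>+r. ennreal (norm (indicator {s..b} r *\<^sub>R h (y + r *\<^sub>R e))) \<partial>lborel)"
          unfolding set_lebesgue_integral_def using integral_norm_bound_ennreal[OF si[unfolded set_integrable_def]] by simp
        also have "\<dots> \<le> H c" unfolding H_def y_def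
          by (intro nn_integral_mono) (auto simp: indicator_def)
        finally show ?thesis .
      qed simp
      moreover have "\<bar>f b\<bar> \<le> M"
        unfolding f_def
      proof (rule face)
        show "y + b *\<^sub>R e \<in> ?Q" using line sab by auto
        show "(y + b *\<^sub>R e) \<bullet> e = u \<bullet> e"
          unfolding y_def inner_sum_Basis_remove[OF e e] by (simp add: b_def)
      qed
      then have "\<bar>f s\<bar> \<le> M + \<bar>f b - f s\<bar>" by linarith
      then have "ennreal \<bar>f s\<bar> \<le> ennreal M + ennreal \<bar>f b - f s\<bar>"
        using \<open>\<bar>f b\<bar> \<le> M\<close> by (metis abs_ge_zero ennreal_leI ennreal_plus order_trans)
      ultimately have "ennreal \<bar>f s\<bar> \<le> ennreal M + H c"
        by (meson add_left_mono order_trans)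
      then show ?thesis using True sab by (simp add: f_def y_def)
    qed (simp add: y_def)
  qed
  have gm: "(\<lambda>x. indicator ?Q x *\<^sub>R g x) \<in> borel_measurable borel"
  proof -
    have "g \<in> borel_measurable (restrict_space borel U)" using gACL by (simp add: ACL_def)
    then have "g \<in> borel_measurable (restrict_space borel ?Q)"
      by (rule measurable_restrict_mono) (rule U(1))
    then show ?thesis by (subst (asm) borel_measurable_restrict_space_iff) auto
  qed
  have "(\<integral>\<^sup>+x. ennreal \<bar>indicator ?Q x *\<^sub>R g x\<bar> \<partial>lborel)
      = (\<integral>\<^sup>+c. (\<integral>\<^sup>+s. ennreal \<bar>indicator ?Q (?y c + s *\<^sub>R e) *\<^sub>R g (?y c + s *\<^sub>R e)\<bar> \<partial>lborel) \<partial>?M)"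
    by (intro nn_integral_lborel_split_axis[OF e] measurable_compose[OF _ measurable_ennreal]
      borel_measurable_abs gm)
  also have "\<dots> \<le> (\<integral>\<^sup>+c. (\<integral>\<^sup>+s. ennreal M * indicator ?Q (?y c + s *\<^sub>R e) + H c * indicator {a..b} s \<partial>lborel) \<partial>?M)"
  proof (rule nn_integral_mono_AE, use bound in eventually_elim, rule nn_integral_mono)
    fix c s
    assume *: "\<forall>s. indicator ?Q (?y c + s *\<^sub>R e) * ennreal \<bar>g (?y c + s *\<^sub>R e)\<bar>
      \<le> ennreal M * indicator ?Q (?y c + s *\<^sub>R e) + H c * indicator {a..b} s"
    have "ennreal \<bar>indicator ?Q (?y c + s *\<^sub>R e) *\<^sub>R g (?y c + s *\<^sub>R e)\<bar>
        = indicator ?Q (?y c + s *\<^sub>R e) * ennreal \<bar>g (?y c + s *\<^sub>R e)\<bar>"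
      by (simp add: indicator_def)
    then show "ennreal \<bar>indicator ?Q (?y c + s *\<^sub>R e) *\<^sub>R g (?y c + s *\<^sub>R e)\<bar>
        \<le> ennreal M * indicator ?Q (?y c + s *\<^sub>R e) + H c * indicator {a..b} s"
      using *[rule_format, of s] by simp
  qed
  also have "\<dots> = (\<integral>\<^sup>+c. (\<integral>\<^sup>+s. ennreal M * indicator ?Q (?y c + s *\<^sub>R e) \<partial>lborel) \<partial>?M)
      + (\<integral>\<^sup>+c. H c * emeasure lborel {a..b} \<partial>?M)"
    by (simp add: nn_integral_add nn_integral_cmult)
  also have "(\<integral>\<^sup>+c. (\<integral>\<^sup>+s. ennreal M * indicator ?Q (?y c + s *\<^sub>R e) \<partial>lborel) \<partial>?M)
      = ennreal M * emeasure lborel ?Q"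
    by (subst nn_integral_lborel_split_axis[OF e, symmetric]) (auto simp: nn_integral_cmult)
  \<comment> \<open>The splitting read backwards: the line integrals \<open>H\<close> add up to the
    integral of \<open>\<bar>h\<bar>\<close> over the space.\<close>
  also have "(\<integral>\<^sup>+c. H c * emeasure lborel {a..b} \<partial>?M)
      = (\<integral>\<^sup>+x. ennreal \<bar>h x\<bar> \<partial>lborel) * emeasure lborel {a..b}"
    unfolding H_def by (subst nn_integral_lborel_split_axis[OF e]) (auto simp: nn_integral_multc)
  also have "ennreal M * emeasure lborel ?Q + (\<integral>\<^sup>+x. ennreal \<bar>h x\<bar> \<partial>lborel) * emeasure lborel {a..b} < \<infinity>"
    using hfin emeasure_lborel_cbox_finite[of l u] emeasure_lborel_cbox_finite[of a b]
    by (auto simp: ennreal_mult_less_top less_top)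
  finally have "integrable lborel (\<lambda>x. indicator ?Q x *\<^sub>R g x)"
    using gm by (intro integrableI_bounded) auto
  then show ?thesis
    using gm unfolding set_integrable_def by (subst integrable_completion) auto
qed

section \<open>Products with smooth functions\<close>

lemma ACL_subset:
  assumes g: "g \<in> ACL U" and "V \<subseteq> U"
  shows "g \<in> ACL V"
  unfolding ACL_def
proof (intro CollectI conjI allI impI)
  have "g \<in> borel_measurable (restrict_space borel U)" using g by (simp add: ACL_def)
  then show "g \<in> borel_measurable (restrict_space borel V)"
    by (rule measurable_restrict_mono) fact
  fix e :: 'a and B assume "norm e = 1" "orthonormal_basis_of_complement e B"
  then have "AE c in (\<Pi>\<^sub>M b\<in>B. lborel).
          let y = (\<Sum>b\<in>B. c b *\<^sub>R b) in
           \<forall>a b. a \<le> b \<longrightarrow> (\<forall>s\<in>{a..b}. y + s *\<^sub>R e \<in> U) \<longrightarrow>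
             abs_cont_on_interval a b (\<lambda>s. g (y + s *\<^sub>R e))"
    using g by (auto simp: ACL_def)
  then show "AE c in (\<Pi>\<^sub>M b\<in>B. lborel).
          let y = (\<Sum>b\<in>B. c b *\<^sub>R b) in
           \<forall>a b. a \<le> b \<longrightarrow> (\<forall>s\<in>{a..b}. y + s *\<^sub>R e \<in> V) \<longrightarrow>
             abs_cont_on_interval a b (\<lambda>s. g (y + s *\<^sub>R e))"
    by eventually_elim (use \<open>V \<subseteq> U\<close> in \<open>unfold Let_def, blast\<close>)
qed

lemma ACL1_subset:
  assumes g: "g \<in> ACL1 U" and "V \<subseteq> U" "V \<in> sets lebesgue"
  shows "g \<in> ACL1 V"
  unfolding ACL1_def
proof (intro CollectI conjI allI impI)
  show "g \<in> ACL V" using g ACL_subset[OF _ \<open>V \<subseteq> U\<close>] by (auto simp: ACL1_def)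
  fix e :: 'a assume "norm e = 1"
  then have "AE x in lebesgue. x \<in> U \<longrightarrow> (\<lambda>s. g (x + s *\<^sub>R e)) differentiable (at 0)"
    and "set_integrable lebesgue U (dir_deriv e g)"
    using g by (auto simp: ACL1_def)
  then show "set_integrable lebesgue V (dir_deriv e g)"
    and "AE x in lebesgue. x \<in> V \<longrightarrow> (\<lambda>s. g (x + s *\<^sub>R e)) differentiable (at 0)"
    using \<open>V \<subseteq> U\<close> by (blast intro: set_integrable_subset[OF _ assms(3,2)], auto elim: eventually_mono)
qed

lemma has_derivative_inner_imp_line:
  fixes P :: "'a::real_inner \<Rightarrow> real"
  assumes "\<And>x. (P has_derivative (\<lambda>h. D x \<bullet> h)) (at x)"
  shows "((\<lambda>s. P (x + s *\<^sub>R e)) has_real_derivative D (x + s *\<^sub>R e) \<bullet> e) (at s)"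
proof -
  have "((\<lambda>s. x + s *\<^sub>R e) has_derivative (\<lambda>s. s *\<^sub>R e)) (at s)"
    by (auto intro!: derivative_eq_intros)
  from has_derivative_compose[OF this assms]
  show ?thesis by (simp add: has_field_derivative_def mult_commute_abs)
qed

lemma set_integrable_mult_bounded:
  fixes f k :: "'a::euclidean_space \<Rightarrow> real"
  assumes f: "set_integrable lebesgue V f" and V: "V \<in> sets lebesgue"
    and k: "k \<in> borel_measurable lebesgue"
    and M: "\<And>x. x \<in> V \<Longrightarrow> \<bar>k x\<bar> \<le> M"
  shows "set_integrable lebesgue V (\<lambda>x. f x * k x)"
  unfolding set_integrable_def
proof (rule Bochner_Integration.integrable_bound)
  show "integrable lebesgue (\<lambda>x. M * (indicator V x *\<^sub>R f x))"
    using f by (simp add: set_integrable_def)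
  have "(\<lambda>x. (indicator V x *\<^sub>R f x) * k x) \<in> borel_measurable lebesgue"
    using f k unfolding set_integrable_def by (intro borel_measurable_times) auto
  then show "(\<lambda>x. indicator V x *\<^sub>R (f x * k x)) \<in> borel_measurable lebesgue"
    by (simp add: mult.assoc)
  have "\<bar>f x\<bar> * \<bar>k x\<bar> \<le> \<bar>M\<bar> * \<bar>f x\<bar>" if "x \<in> V" for x
    using M[OF that] by (subst mult.commute, intro mult_right_mono) auto
  then show "AE x in lebesgue. norm (indicator V x *\<^sub>R (f x * k x)) \<le> norm (M * (indicator V x *\<^sub>R f x))"
    by (intro AE_I2) (auto simp: indicator_def abs_mult)
qed

text \<open>On the compact closure of \<open>V\<close> both \<open>P\<close> and its gradient are
  bounded. Hence \<open>P\<close> is Lipschitz on segments inside \<open>V\<close>, and products on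
  lines stay absolutely continuous. In the product rule, the term with the derivative of
  \<open>g\<close> is integrable by \<open>ACL1\<close>, and the term with \<open>g\<close> itself
  by \<open>gint\<close>.\<close>

lemma ACL1_mult_smooth:
  fixes g P :: "'a::euclidean_space \<Rightarrow> real"
  assumes g: "g \<in> ACL1 V" and gint: "set_integrable lebesgue V g"
    and V: "open V" "bounded V"
    and P: "\<And>x. (P has_derivative (\<lambda>h. D x \<bullet> h)) (at x)" and D: "continuous_on UNIV D"
  shows "(\<lambda>x. g x * P x) \<in> ACL1 V"
proof -
  have Pc: "continuous_on UNIV P"
    using P by (meson continuous_at_imp_continuous_on has_derivative_continuous)
  have cl: "compact (closure V)" using V(2) by (simp add: compact_closure)
  have "compact (P ` closure V)" "compact (D ` closure V)"
    using cl Pc D by (auto intro!: compact_continuous_image intro: continuous_on_subset)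
  then have "bounded (P ` closure V)" "bounded (D ` closure V)"
    by (auto intro: compact_imp_bounded)
  then obtain M L where M0: "\<And>x. x \<in> closure V \<Longrightarrow> \<bar>P x\<bar> \<le> M" and L0: "\<And>x. x \<in> closure V \<Longrightarrow> norm (D x) \<le> L"
    unfolding bounded_iff real_norm_def by (metis imageI)
  have M: "\<bar>P x\<bar> \<le> M" and L: "norm (D x) \<le> L" if "x \<in> V" for x
    using M0[of x] L0[of x] that closure_subset by auto
  have Vm: "V \<in> sets lebesgue" using V(1) by auto
  have gA: "g \<in> ACL V" using g by (simp add: ACL1_def)
  have line: "((\<lambda>s. P (x + s *\<^sub>R e)) has_real_derivative D (x + s *\<^sub>R e) \<bullet> e) (at s)" for x e s
    by (rule has_derivative_inner_imp_line[OF P])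
  show ?thesis
    unfolding ACL1_def
  proof (intro CollectI conjI allI impI)
    show "(\<lambda>x. g x * P x) \<in> ACL V"
      unfolding ACL_def
    proof (intro CollectI conjI allI impI)
      have "P \<in> borel_measurable (restrict_space borel V)"
        using borel_measurable_continuous_onI[OF Pc] by (rule measurable_restrict_space1)
      then show "(\<lambda>x. g x * P x) \<in> borel_measurable (restrict_space borel V)"
        using gA by (auto simp: ACL_def)
      fix e :: 'a and B assume e: "norm e = 1" and B: "orthonormal_basis_of_complement e B"
      have "AE c in (\<Pi>\<^sub>M b\<in>B. lborel).
          let y = (\<Sum>b\<in>B. c b *\<^sub>R b) in
           \<forall>a b. a \<le> b \<longrightarrow> (\<forall>s\<in>{a..b}. y + s *\<^sub>R e \<in> V) \<longrightarrow>
             abs_cont_on_interval a b (\<lambda>s. g (y + s *\<^sub>R e))"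
        using gA e B by (auto simp: ACL_def)
      then show "AE c in (\<Pi>\<^sub>M b\<in>B. lborel).
          let y = (\<Sum>b\<in>B. c b *\<^sub>R b) in
           \<forall>a b. a \<le> b \<longrightarrow> (\<forall>s\<in>{a..b}. y + s *\<^sub>R e \<in> V) \<longrightarrow>
             abs_cont_on_interval a b (\<lambda>s. g (y + s *\<^sub>R e) * P (y + s *\<^sub>R e))"
      proof (eventually_elim, unfold Let_def, intro allI impI)
        fix c a b
        let ?y = "\<Sum>b\<in>B. c b *\<^sub>R b"
        assume ac: "\<forall>a b. a \<le> b \<longrightarrow> (\<forall>s\<in>{a..b}. ?y + s *\<^sub>R e \<in> V) \<longrightarrow>
             abs_cont_on_interval a b (\<lambda>s. g (?y + s *\<^sub>R e))"
          and "a \<le> b" and seg: "\<forall>s\<in>{a..b}. ?y + s *\<^sub>R e \<in> V"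
        have "abs_cont_on_interval a b (\<lambda>s. P (?y + s *\<^sub>R e))"
        proof (rule abs_cont_on_interval_lipschitz)
          fix s t :: real assume "s \<in> {a..b}" "t \<in> {a..b}"
          \<comment> \<open>\<open>V\<close> may fail to be convex; the mean value bound is applied
            along a segment known to lie in \<open>V\<close>.\<close>
          have "norm (P (?y + s *\<^sub>R e) - P (?y + t *\<^sub>R e)) \<le> L * norm (s - t)"
          proof (rule field_differentiable_bound[where S="{a..b}" and f="\<lambda>s. P (?y + s *\<^sub>R e)"])
            show "((\<lambda>s. P (?y + s *\<^sub>R e)) has_field_derivative D (?y + z *\<^sub>R e) \<bullet> e) (at z within {a..b})" for z
              by (rule DERIV_subset[OF line]) simp
            show "norm (D (?y + z *\<^sub>R e) \<bullet> e) \<le> L" if "z \<in> {a..b}" for z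
              using Cauchy_Schwarz_ineq2[of "D (?y + z *\<^sub>R e)" e] L seg that e by force
          qed (use \<open>s \<in> _\<close> \<open>t \<in> _\<close> in auto)
          then show "\<bar>P (?y + s *\<^sub>R e) - P (?y + t *\<^sub>R e)\<bar> \<le> L * \<bar>s - t\<bar>" by simp
        qed
        then show "abs_cont_on_interval a b (\<lambda>s. g (?y + s *\<^sub>R e) * P (?y + s *\<^sub>R e))"
          using ac seg \<open>a \<le> b\<close> by (intro abs_cont_on_interval_mult) auto
      qed
    qed
    fix e :: 'a assume e: "norm e = 1"
    have diff: "AE x in lebesgue. x \<in> V \<longrightarrow> (\<lambda>s. g (x + s *\<^sub>R e)) differentiable (at 0)"
      and dint: "set_integrable lebesgue V (dir_deriv e g)"
      using g e by (auto simp: ACL1_def)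
    have Pd: "((\<lambda>s. P (x + s *\<^sub>R e)) has_real_derivative D x \<bullet> e) (at 0)" for x
      using line[of x e 0] by simp
    have prod: "((\<lambda>s. g (x + s *\<^sub>R e) * P (x + s *\<^sub>R e)) has_real_derivative
        dir_deriv e g x * P x + g x * (D x \<bullet> e)) (at 0)"
      if "(\<lambda>s. g (x + s *\<^sub>R e)) differentiable (at 0)" for x
    proof -
      have "((\<lambda>s. g (x + s *\<^sub>R e)) has_real_derivative dir_deriv e g x) (at 0)"
        using that by (simp add: dir_deriv_def DERIV_deriv_iff_real_differentiable)
      from DERIV_mult[OF this Pd] show ?thesis by (simp add: algebra_simps)
    qed
    show "AE x in lebesgue. x \<in> V \<longrightarrow> (\<lambda>s. g (x + s *\<^sub>R e) * P (x + s *\<^sub>R e)) differentiable (at 0)"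
      using diff by eventually_elim (use prod in \<open>auto simp: real_differentiable_def\<close>)
    have Pm: "P \<in> borel_measurable lebesgue"
      using borel_measurable_continuous_onI[OF Pc] by (simp add: measurable_completion)
    have Dm: "(\<lambda>x. D x \<bullet> e) \<in> borel_measurable lebesgue"
      using borel_measurable_continuous_onI[OF continuous_on_inner[OF D continuous_on_const]]
      by (simp add: measurable_completion)
    have "set_integrable lebesgue V (\<lambda>x. dir_deriv e g x * P x)"
      by (rule set_integrable_mult_bounded[OF dint Vm Pm M])
    moreover have "set_integrable lebesgue V (\<lambda>x. g x * (D x \<bullet> e))"
    proof (rule set_integrable_mult_bounded[OF gint Vm Dm])
      show "\<bar>D x \<bullet> e\<bar> \<le> L" if "x \<in> V" for x
        using Cauchy_Schwarz_ineq2[of "D x" e] L[OF that] e by auto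
    qed
    ultimately have int: "set_integrable lebesgue V (\<lambda>x. dir_deriv e g x * P x + g x * (D x \<bullet> e))"
      by (rule set_integral_add)
    \<comment> \<open>The product rule holds only almost everywhere. Integrability passes across
      this equality, and so does measurability because Lebesgue measure is complete.\<close>
    have ae: "AE x in lebesgue. indicator V x *\<^sub>R (dir_deriv e g x * P x + g x * (D x \<bullet> e))
        = indicator V x *\<^sub>R dir_deriv e (\<lambda>x. g x * P x) x"
      using diff
    proof eventually_elim
      case (elim x)
      show ?case
      proof (cases "x \<in> V")
        case True
        then show ?thesis
          using DERIV_imp_deriv[OF prod] elim by (simp add: dir_deriv_def)
      qed simp
    qed
    show "set_integrable lebesgue V (dir_deriv e (\<lambda>x. g x * P x))"
      unfolding set_integrable_def
      by (rule integrable_cong_AE_imp[OF int[unfolded set_integrable_def] _ ae])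
        (rule borel_measurable_AE[OF _ ae], use int in \<open>simp add: set_integrable_def borel_measurable_integrable\<close>)
  qed
qed

section \<open>Elliptical densities\<close>

text \<open>The root \<open>s\<close> of \<open>s * w + s\<^sup>2 * v / 2 = r\<close> on the branch
  that vanishes at \<open>r = 0\<close>; the factor \<open>sgn w\<close> selects that
  branch.\<close>

definition parabola_inv :: "real \<Rightarrow> real \<Rightarrow> real \<Rightarrow> real" where
  "parabola_inv w v r = (sgn w * sqrt (w\<^sup>2 + 2 * v * r) - w) / v"

lemma parabola_inv_0 [simp]: "parabola_inv w v 0 = 0"
  by (simp add: parabola_inv_def sgn_if)

text \<open>Completing the square: the equation says that \<open>v * s + w\<close> squares to
  \<open>w\<^sup>2 + 2 * v * r\<close>.\<close>

lemma parabola_inv_eq: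
  assumes "w \<noteq> 0" "v \<noteq> 0" "0 \<le> w\<^sup>2 + 2 * v * r"
  defines "s \<equiv> parabola_inv w v r"
  shows "s * w + s\<^sup>2 * v / 2 = r"
proof -
  have "v * s + w = sgn w * sqrt (w\<^sup>2 + 2 * v * r)"
    using assms by (simp add: parabola_inv_def)
  then have "(v * s + w)\<^sup>2 = (sgn w)\<^sup>2 * (sqrt (w\<^sup>2 + 2 * v * r))\<^sup>2"
    by (simp only: power_mult_distrib)
  also have "(sgn w)\<^sup>2 = 1" using assms(1) by (simp add: sgn_if)
  finally have "v * (s * w + s\<^sup>2 * v / 2) = v * r"
    using assms(3) by (simp add: power2_eq_square algebra_simps)
  then show ?thesis using assms(2) by simp
qed

lemma DERIV_parabola_inv:
  assumes "w \<noteq> 0" "v \<noteq> 0"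
  shows "\<exists>R'. ((\<lambda>\<tau>. parabola_inv w v (\<tau> - t)) has_real_derivative R') (at t)"
  unfolding parabola_inv_def using assms
  by (intro exI) (rule derivative_eq_intros refl | simp)+

text \<open>Joint continuity in \<open>w\<close> and \<open>r\<close>. The condition
  \<open>f x \<noteq> 0\<close> is there for the sign factor; \<open>sqrt\<close> is continuous on
  the whole real line.\<close>

lemma continuous_parabola_inv:
  fixes f g :: "'a::t2_space \<Rightarrow> real"
  assumes "isCont f x" "isCont g x" "f x \<noteq> 0" "v \<noteq> 0"
  shows "isCont (\<lambda>z. parabola_inv (f z) v (g z)) x"
  unfolding parabola_inv_def using assms
  by (intro continuous_intros isCont_sgn) auto

lemma isCont_tendsto_nhds: "isCont f x \<Longrightarrow> (f \<longlongrightarrow> f x) (nhds x)"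
  by (simp add: isCont_def tendsto_at_iff_tendsto_nhds)

lemma AE_lborel_ex_in_open:
  fixes S :: "'a::euclidean_space set"
  assumes "AE x in lborel. P x" "open S" "S \<noteq> {}"
  shows "\<exists>x\<in>S. P x"
proof (rule ccontr)
  assume "\<not> ?thesis"
  then have "AE x in lebesgue. x \<notin> S"
    using AE_completion[OF assms(1)] by (auto elim: eventually_mono)
  then have "negligible S"
    unfolding negligible_iff_null_sets using assms(2) by (subst (asm) AE_iff_null_sets[symmetric]) auto
  then show False using open_not_negligible assms by blast
qed

lemma AE_lebesgue_not_in_negligible: "negligible S \<Longrightarrow> AE x in lebesgue. x \<notin> S"
  by (simp add: negligible_iff_null_sets AE_not_in)

section \<open>The kernel and the quadratic form of an elliptical density\<close>

locale elliptical =
  fixes \<nu> :: "real^'n" and \<Sigma> :: "real^'n^'n"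
    and \<phi> \<phi>1 \<phi>2 :: "real \<Rightarrow> real" and \<delta> :: real
  assumes card: "CARD('n) \<ge> 2"
    and spd: "sym_pos_def \<Sigma>"
    and \<phi>_pos: "\<And>t. t \<ge> 0 \<Longrightarrow> \<phi> t > 0"
    and \<phi>_deriv: "\<And>t. t \<ge> 0 \<Longrightarrow> (\<phi> has_real_derivative \<phi>1 t) (at t within {0..})"
    and \<phi>1_deriv: "\<And>t. t \<ge> 0 \<Longrightarrow> (\<phi>1 has_real_derivative \<phi>2 t) (at t within {0..})"
    and \<phi>1_nz: "\<And>t. t \<ge> 0 \<Longrightarrow> \<phi>1 t \<noteq> 0"
    and \<delta>: "\<delta> \<noteq> 2"
begin

definition "W = matrix_inv \<Sigma>"

abbreviation "T \<equiv> half_quad \<nu> \<Sigma>"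

definition grad :: "real^'n \<Rightarrow> real^'n" where "grad x = W *v (x - \<nu>)"

definition c :: "real \<Rightarrow> real" where "c t = \<phi>2 t * \<phi> t / (\<phi>1 t)\<^sup>2 - \<delta>"

definition q :: "'n \<Rightarrow> 'n \<Rightarrow> real^'n \<Rightarrow> real" where
  "q i j x = 2 * T x * \<Sigma> $ i $ j - (x - \<nu>) $ i * (x - \<nu>) $ j"

abbreviation "\<tau> \<equiv> tau_delta \<nu> \<Sigma> \<phi> \<phi>1 \<phi>2 \<delta>"

text \<open>Since \<open>c t = - (\<phi> t / \<phi>1 t) * r\<close>, the denominator
  \<open>r\<close> cancels where it is nonzero. Both branches of the definition therefore follow one
  formula.\<close>

lemma tau_eq:
  "\<tau> x $ i $ j = (- (real CARD('n) - 1) * (\<phi> (T x) / \<phi>1 (T x)) * \<Sigma> $ i $ j + c (T x) * q i j x) / ((2 - \<delta>) * (real CARD('n) - 1))"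
  if T0: "0 \<le> T x"
proof -
  define t where "t = T x"
  define r where "r = \<delta> * (\<phi>1 t / \<phi> t) - \<phi>2 t / \<phi>1 t"
  have nz: "\<phi> t \<noteq> 0" "\<phi>1 t \<noteq> 0" using \<phi>_pos[OF T0] \<phi>1_nz[OF T0] by (auto simp: t_def)
  have c: "(\<phi>2 t / \<phi>1 t) / (\<phi>1 t / \<phi> t) - \<delta> = c t" by (simp add: c_def power2_eq_square)
  define K where "K = (2 - \<delta>) * (real CARD('n) - 1)"
  show ?thesis
  proof (cases "r = 0")
    case True
    then show ?thesis
      unfolding tau_delta_def Let_def t_def[symmetric] r_def[symmetric] c q_def K_def[symmetric]
      by (simp add: outer_def)
  next
    case False
    have "c t / r = - (\<phi> t / \<phi>1 t)"
      using nz False by (simp add: c_def r_def field_simps power2_eq_square)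
    then have *: "c t * ((real CARD('n) - 1) / r + 2 * t)
        = - (real CARD('n) - 1) * (\<phi> t / \<phi>1 t) + c t * (2 * t)"
    proof -
      have "c t * ((real CARD('n) - 1) / r + 2 * t) = (real CARD('n) - 1) * (c t / r) + c t * (2 * t)"
        by (simp add: distrib_left mult.commute)
      then show ?thesis unfolding \<open>c t / r = _\<close> by (simp only: mult_minus_left mult_minus_right)
    qed
    have "\<tau> x $ i $ j = (c t * ((real CARD('n) - 1) / r + 2 * t) * \<Sigma> $ i $ j
        - c t * ((x - \<nu>) $ i * (x - \<nu>) $ j)) / K"
      using False unfolding tau_delta_def Let_def t_def[symmetric] r_def[symmetric] c K_def[symmetric]
      by (simp add: outer_def right_diff_distrib diff_divide_distrib)
    then show ?thesis
      unfolding * q_def t_def[symmetric] K_def[symmetric] by (simp add: algebra_simps)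
  qed
qed

lemma \<Sigma>_inner: "(\<Sigma> *v x) \<bullet> y = x \<bullet> (\<Sigma> *v y)"
  using spd by (metis sym_pos_def_def dot_lmul_matrix transpose_matrix_vector)

lemma invertible_\<Sigma>: "invertible \<Sigma>"
proof -
  have "x = 0" if "\<Sigma> *v x = 0" for x :: "real^'n"
    using spd that by (auto simp: sym_pos_def_def)
  then show ?thesis by (simp add: invertible_left_inverse matrix_left_invertible_ker)
qed

lemma \<Sigma>_W: "\<Sigma> *v (W *v x) = x" and W_\<Sigma>: "W *v (\<Sigma> *v x) = x"
proof -
  have "\<Sigma> ** W = mat 1 \<and> W ** \<Sigma> = mat 1"
    using invertible_\<Sigma> unfolding W_def matrix_inv_def invertible_def by (rule someI_ex)
  then show "\<Sigma> *v (W *v x) = x" "W *v (\<Sigma> *v x) = x"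
    by (simp_all add: matrix_vector_mul_assoc)
qed

lemma W_inner: "(W *v x) \<bullet> y = x \<bullet> (W *v y)"
  by (metis \<Sigma>_inner \<Sigma>_W)

lemma W_pos: "x \<noteq> 0 \<Longrightarrow> 0 < x \<bullet> (W *v x)"
  using spd by (metis \<Sigma>_W sym_pos_def_def inner_commute matrix_vector_mult_0_right)

lemma T_eq: "T x = 1/2 * ((x - \<nu>) \<bullet> grad x)"
  by (simp add: half_quad_def grad_def W_def)

lemma T_nonneg: "0 \<le> T x"
  using W_pos[of "x - \<nu>"] by (cases "x = \<nu>") (auto simp: T_eq grad_def)

lemma T_pos: "x \<noteq> \<nu> \<Longrightarrow> 0 < T x"
  using W_pos[of "x - \<nu>"] by (simp add: T_eq grad_def)

text \<open>The increment has the form \<open>s * w + s\<^sup>2 * v / 2\<close> with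
  \<open>w = grad x \<bullet> e\<close> and \<open>v > 0\<close> for \<open>e \<noteq> 0\<close>,
  which \<open>parabola_inv\<close> inverts.\<close>

lemma T_line: "T (x + s *\<^sub>R e) = T x + (s * (grad x \<bullet> e) + s\<^sup>2 * (e \<bullet> (W *v e)) / 2)"
proof -
  define y where "y = x - \<nu>"
  have "x + s *\<^sub>R e - \<nu> = y + s *\<^sub>R e" by (simp add: y_def)
  moreover have "e \<bullet> (W *v y) = y \<bullet> (W *v e)" by (metis W_inner inner_commute)
  moreover have "(W *v y) \<bullet> e = y \<bullet> (W *v e)" by (rule W_inner)
  ultimately show ?thesis
    unfolding T_eq grad_def y_def[symmetric]
    by (simp add: matrix_vector_right_distrib matrix_vector_mult_scaleR inner_simps y_def[symmetric]
        power2_eq_square algebra_simps)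
qed

lemma T_has_derivative: "(T has_derivative (\<lambda>h. grad x \<bullet> h)) (at x)"
proof -
  have "T = (\<lambda>x. 1/2 * ((x - \<nu>) \<bullet> (W *v (x - \<nu>))))"
    by (auto simp: T_eq grad_def)
  moreover have "((\<lambda>x. 1/2 * ((x - \<nu>) \<bullet> (W *v (x - \<nu>)))) has_derivative
      (\<lambda>h. 1/2 * ((x - \<nu>) \<bullet> (W *v h) + h \<bullet> (W *v (x - \<nu>))))) (at x)"
    by (auto intro!: derivative_eq_intros bounded_linear.has_derivative[OF matrix_vector_mul_bounded_linear])
  moreover have "1/2 * ((x - \<nu>) \<bullet> (W *v h) + h \<bullet> (W *v (x - \<nu>))) = grad x \<bullet> h" for h
    using W_inner[of "x - \<nu>" h] by (simp add: grad_def inner_commute)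
  ultimately show ?thesis by simp
qed

lemma grad_continuous: "continuous_on A grad"
  unfolding grad_def[abs_def]
  by (intro continuous_intros bounded_linear.continuous_on[OF matrix_vector_mul_bounded_linear])

lemma T_continuous: "continuous_on A T"
  by (meson T_has_derivative continuous_at_imp_continuous_on has_derivative_continuous)

lemma q_continuous: "continuous_on A (q i j)"
  unfolding q_def[abs_def] by (intro continuous_intros T_continuous)

text \<open>Transversality of axis-parallel lines to the level sets of \<open>T\<close> fails only
  on a hyperplane through \<open>\<nu>\<close> with normal \<open>W *v axis k 1\<close>.\<close>

lemma grad_zero_negligible: "negligible {x. grad x \<bullet> axis k 1 = 0}"
proof -
  let ?a = "W *v axis k 1"
  have "?a \<noteq> 0" using W_pos[of "axis k 1"] by (auto simp: axis_eq_0_iff)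
  moreover have "grad x \<bullet> axis k 1 = ?a \<bullet> x - ?a \<bullet> \<nu>" for x
    unfolding grad_def W_inner[of "x - \<nu>"] by (simp only: inner_commute[of "x - \<nu>"] inner_diff_right)
  then have "{x. grad x \<bullet> axis k 1 = 0} = {x. ?a \<bullet> x = ?a \<bullet> \<nu>}" by simp
  ultimately show ?thesis using negligible_hyperplane[of ?a "?a \<bullet> \<nu>"] by simp
qed

text \<open>By the equality case of Cauchy--Schwarz for the form \<open>W\<close>.\<close>

lemma q_zero_negligible: "negligible {x. q k k x = 0}"
proof -
  define a where "a = \<Sigma> *v axis k 1"
  have Wa: "W *v a = axis k 1" by (simp add: a_def W_\<Sigma>)
  have aWa: "a \<bullet> (W *v a) = \<Sigma> $ k $ k"
    unfolding Wa by (simp add: a_def inner_axis matrix_vector_mult_basis column_def)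
  have "a \<noteq> 0" using Wa by (metis axis_eq_0_iff matrix_vector_mult_0_right zero_neq_one)
  then have pos: "0 < \<Sigma> $ k $ k" using W_pos aWa by metis
  have "x \<in> (+) \<nu> ` span {a}" if "q k k x = 0" for x
  proof -
    define y where "y = x - \<nu>"
    define z where "z = (\<Sigma> $ k $ k) *\<^sub>R y - (y $ k) *\<^sub>R a"
    have yWa: "y \<bullet> (W *v a) = y $ k" by (simp add: Wa inner_axis)
    have aWy: "a \<bullet> (W *v y) = y $ k" using yWa by (metis W_inner inner_commute)
    have yWy: "y \<bullet> (W *v y) = 2 * T x" by (simp add: T_eq grad_def y_def)
    have "z \<bullet> (W *v z) = (\<Sigma> $ k $ k)\<^sup>2 * (2 * T x) - \<Sigma> $ k $ k * (y $ k)\<^sup>2"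
      unfolding z_def
      by (simp add: matrix_vector_mult_diff_distrib matrix_vector_mult_scaleR inner_simps yWa aWy yWy aWa
          power2_eq_square algebra_simps)
    also have "\<dots> = \<Sigma> $ k $ k * q k k x"
      by (simp add: q_def y_def power2_eq_square algebra_simps)
    finally have "z = 0" using W_pos[of z] that by auto
    then have eq: "(\<Sigma> $ k $ k) *\<^sub>R y = (y $ k) *\<^sub>R a" by (simp add: z_def)
    have "y = (1 / \<Sigma> $ k $ k) *\<^sub>R ((\<Sigma> $ k $ k) *\<^sub>R y)" using pos by simp
    also have "\<dots> \<in> span {a}" unfolding eq by (intro span_scale span_base) simp
    finally have "y \<in> span {a}" .
    then show ?thesis by (intro image_eqI[of _ _ y]) (auto simp: y_def)
  qed
  then have "{x. q k k x = 0} \<subseteq> (+) \<nu> ` span {a}" by blast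
  moreover have "negligible (span {a})"
  proof (rule negligible_lowdim)
    have "dim (span {a}) \<le> 1" using dim_le_card[of "{a}" "{a}"] by (simp add: span_superset)
    then show "dim (span {a}) < DIM(real^'n)" using card by simp
  qed
  ultimately show ?thesis using negligible_subset negligible_translation by blast
qed

section \<open>Regularity of \<open>c\<close>, recovered from a diagonal entry of the kernel along
  transversal lines\<close>

lemma \<phi>_ratio_deriv:
  assumes "0 \<le> t"
  shows "((\<lambda>t. \<phi> t / \<phi>1 t) has_real_derivative 1 - \<delta> - c t) (at t within {0..})"
  using DERIV_divide[OF \<phi>_deriv \<phi>1_deriv \<phi>1_nz, OF assms assms assms] \<phi>1_nz[OF assms]
  by (simp add: c_def field_simps power2_eq_square)

lemma T_line_deriv: "((\<lambda>s. T (x + s *\<^sub>R e)) has_real_derivative grad x \<bullet> e) (at 0)"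
  using has_derivative_inner_imp_line[OF T_has_derivative, where s=0 and e=e] by simp

lemma q_line_deriv:
  "((\<lambda>s. q i j (x + s *\<^sub>R axis k 1)) has_real_derivative
     2 * (grad x \<bullet> axis k 1) * \<Sigma> $ i $ j
     - (of_bool (i = k) * (x - \<nu>) $ j + (x - \<nu>) $ i * of_bool (j = k))) (at 0)"
proof -
  have comp: "(x + s *\<^sub>R axis k 1 - \<nu>) $ l = (x - \<nu>) $ l + s * of_bool (l = k)" for s l
    by (simp add: axis_def)
  show ?thesis
    unfolding q_def comp
    by (auto intro!: derivative_eq_intros T_line_deriv)
qed

lemma q_nonzero_imp_T_pos: "q k k x \<noteq> 0 \<Longrightarrow> 0 < T x"
  using T_pos[of x] by (cases "x = \<nu>") (auto simp: q_def T_eq)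

lemma at_within_nonneg: "0 < t \<Longrightarrow> at t within {0::real..} = at t"
  by (rule at_within_interior) simp

text \<open>The formula \<open>tau_eq\<close> for a diagonal entry, solved for
  \<open>c (T x)\<close>. It is written with \<open>\<tau>\<close> instead of \<open>c\<close> so
  that regularity of \<open>\<tau>\<close> along a line carries over to it.\<close>

definition \<Gamma> :: "'n \<Rightarrow> real^'n \<Rightarrow> real" where
  "\<Gamma> k x = (\<tau> x $ k $ k * ((2 - \<delta>) * (real CARD('n) - 1))
     + (real CARD('n) - 1) * (\<phi> (T x) / \<phi>1 (T x)) * \<Sigma> $ k $ k) / q k k x"

lemma \<Gamma>_eq: "q k k x \<noteq> 0 \<Longrightarrow> \<Gamma> k x = c (T x)"
proof -
  assume q: "q k k x \<noteq> 0"
  define K where "K = (2 - \<delta>) * (real CARD('n) - 1)"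
  have "K \<noteq> 0" using card \<delta> by (auto simp: K_def)
  then show ?thesis
    using q unfolding \<Gamma>_def tau_eq[OF T_nonneg] K_def[symmetric] mult_minus_left by simp
qed

text \<open>The local inverse of \<open>T\<close> along the line through \<open>x\<close> parallel
  to axis \<open>k\<close>: the parameter at which this line reaches level \<open>t\<close>.\<close>

definition lineparam :: "'n \<Rightarrow> real^'n \<Rightarrow> real \<Rightarrow> real" where
  "lineparam k x t = parabola_inv (grad x \<bullet> axis k 1) (axis k 1 \<bullet> (W *v axis k 1)) (t - T x)"

lemma axis_W_pos: "0 < axis k 1 \<bullet> (W *v axis k 1)"
  by (rule W_pos) (simp add: axis_eq_0_iff)

lemma T_lineparam:
  assumes "grad x \<bullet> axis k 1 \<noteq> 0"
    "0 \<le> (grad x \<bullet> axis k 1)\<^sup>2 + 2 * (axis k 1 \<bullet> (W *v axis k 1)) * (t - T x)"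
  shows "T (x + lineparam k x t *\<^sub>R axis k 1) = t"
  unfolding T_line using parabola_inv_eq[OF assms(1) _ assms(2)] axis_W_pos[of k]
  by (simp add: lineparam_def)

lemma lineparam_T [simp]: "lineparam k x (T x) = 0"
  by (simp add: lineparam_def)

lemma DERIV_lineparam:
  assumes "grad x \<bullet> axis k 1 \<noteq> 0"
  shows "\<exists>R'. (lineparam k x has_real_derivative R') (at (T x))"
  unfolding lineparam_def[abs_def]
  using DERIV_parabola_inv[OF assms, of "axis k 1 \<bullet> (W *v axis k 1)" "T x"] axis_W_pos[of k] by auto

text \<open>Near \<open>T x\<close>, values of \<open>c\<close> can be read off from
  \<open>\<Gamma>\<close> on a single line. For \<open>t\<close> close to \<open>T x\<close> the
  point on the line still has \<open>q k k\<close> nonzero, and the radicand in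
  \<open>lineparam\<close> stays positive.\<close>

lemma c_eq_\<Gamma>_lineparam:
  assumes w: "grad x \<bullet> axis k 1 \<noteq> 0" and q: "q k k x \<noteq> 0"
  shows "\<forall>\<^sub>F t in nhds (T x). c t = \<Gamma> k (x + lineparam k x t *\<^sub>R axis k 1)"
proof -
  let ?w = "grad x \<bullet> axis k 1" and ?v = "axis k 1 \<bullet> (W *v axis k 1)"
  have "isCont (lineparam k x) (T x)" using DERIV_lineparam[OF w] DERIV_isCont by blast
  then have "isCont (\<lambda>t. x + lineparam k x t *\<^sub>R axis k 1) (T x)" by (intro continuous_intros)
  moreover have "isCont (q k k) (x + lineparam k x (T x) *\<^sub>R axis k 1)"
    using q_continuous[of UNIV] by (simp add: continuous_on_eq_continuous_at)
  ultimately have "isCont (\<lambda>t. q k k (x + lineparam k x t *\<^sub>R axis k 1)) (T x)"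
    by (rule isCont_o2)
  then have "((\<lambda>t. q k k (x + lineparam k x t *\<^sub>R axis k 1)) \<longlongrightarrow> q k k x) (nhds (T x))"
    using isCont_tendsto_nhds by force
  then have 1: "\<forall>\<^sub>F t in nhds (T x). q k k (x + lineparam k x t *\<^sub>R axis k 1) \<noteq> 0"
    using q by (rule tendsto_imp_eventually_ne)
  have "((\<lambda>t. ?w\<^sup>2 + 2 * ?v * (t - T x)) \<longlongrightarrow> ?w\<^sup>2 + 2 * ?v * (T x - T x)) (nhds (T x))"
    by (intro tendsto_intros filterlim_ident)
  moreover have "0 < ?w\<^sup>2 + 2 * ?v * (T x - T x)" using w by simp
  ultimately have "\<forall>\<^sub>F t in nhds (T x). 0 < ?w\<^sup>2 + 2 * ?v * (t - T x)"
    by (rule order_tendstoD)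
  with 1 show ?thesis
    by eventually_elim (use T_lineparam[OF w] in \<open>auto simp: \<Gamma>_eq\<close>)
qed

lemma isCont_\<Gamma>_line:
  assumes q: "q k k x \<noteq> 0" and \<tau>: "isCont (\<lambda>s. \<tau> (x + s *\<^sub>R axis k 1) $ k $ k) 0"
  shows "isCont (\<lambda>s. \<Gamma> k (x + s *\<^sub>R axis k 1)) 0"
proof -
  have l: "isCont (\<lambda>s. x + s *\<^sub>R axis k 1) 0" by (intro continuous_intros)
  have T: "isCont (\<lambda>s. T (x + s *\<^sub>R axis k 1)) 0" "isCont (\<lambda>s. q k k (x + s *\<^sub>R axis k 1)) 0"
    using T_continuous[of UNIV] q_continuous[of UNIV]
    by (auto intro!: isCont_o2[OF l] simp: continuous_on_eq_continuous_at)
  have "isCont (\<lambda>t. \<phi> t / \<phi>1 t) (T x)"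
    using \<phi>_ratio_deriv[of "T x"] q_nonzero_imp_T_pos[OF q] DERIV_isCont by (auto simp: at_within_nonneg)
  then have \<psi>: "isCont (\<lambda>s. \<phi> (T (x + s *\<^sub>R axis k 1)) / \<phi>1 (T (x + s *\<^sub>R axis k 1))) 0"
    by (intro isCont_o2[OF T(1)]) simp
  then show ?thesis
    unfolding \<Gamma>_def using q
    by (intro isCont_divide[OF _ T(2)] isCont_add isCont_mult[OF \<tau>] isCont_mult[OF isCont_mult[OF _ \<psi>]]
        continuous_const) simp
qed

text \<open>The two exceptional sets are null, so a generic point exists. Both conditions are
  homogeneous in \<open>x - \<nu>\<close>, so rescaling about \<open>\<nu>\<close> moves this point
  to level \<open>t\<close> and keeps it generic.\<close>

lemma exists_generic_level_point:
  assumes "0 < t"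
  obtains x where "T x = t" "grad x \<bullet> axis k 1 \<noteq> 0" "q k k x \<noteq> 0"
proof -
  have "negligible ({x. grad x \<bullet> axis k 1 = 0} \<union> {x. q k k x = 0})"
    by (intro negligible_Un grad_zero_negligible q_zero_negligible)
  then have "{x. grad x \<bullet> axis k 1 = 0} \<union> {x. q k k x = 0} \<noteq> UNIV"
    using non_negligible_UNIV by metis
  then obtain x where x: "grad x \<bullet> axis k 1 \<noteq> 0" "q k k x \<noteq> 0" by auto
  define r where "r = sqrt (t / T x)"
  have "0 < T x" by (rule q_nonzero_imp_T_pos[OF x(2)])
  then have r: "r \<noteq> 0" "r\<^sup>2 = t / T x" using assms by (auto simp: r_def)
  define z where "z = \<nu> + r *\<^sub>R (x - \<nu>)"
  have g: "grad z = r *\<^sub>R grad x" by (simp add: grad_def z_def matrix_vector_mult_scaleR)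
  then have Tz: "T z = r\<^sup>2 * T x" by (simp add: T_eq z_def power2_eq_square)
  have "q k k z = r\<^sup>2 * q k k x"
    by (simp add: q_def Tz, simp add: z_def power2_eq_square algebra_simps)
  then show thesis using that[of z] Tz g x r \<open>0 < T x\<close> assms by simp
qed

text \<open>Absolute continuity is known on almost every line only, and the line through a
  prescribed generic point \<open>x0\<close> of level \<open>t\<close> may be exceptional. Sliding
  points \<open>z\<close> near \<open>x0\<close> along their own lines to level \<open>t\<close>
  leads to points near \<open>x0\<close>; choosing \<open>z\<close> on a good line gives a generic
  point \<open>x1\<close> of level \<open>t\<close> on a good line.\<close>

lemma c_isCont:
  assumes acl: "(\<lambda>x. \<tau> x $ k $ k) \<in> ACL1_loc UNIV" and "0 < t"
  shows "isCont c t"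
proof -
  obtain x0 where x0: "T x0 = t" "grad x0 \<bullet> axis k 1 \<noteq> 0" "q k k x0 \<noteq> 0"
    using exists_generic_level_point[OF \<open>0 < t\<close>] .
  obtain U where U: "open U" "x0 \<in> U" "(\<lambda>x. \<tau> x $ k $ k) \<in> ACL1 U"
    using acl unfolding ACL1_loc_def by blast
  let ?e = "axis k 1 :: real^'n" and ?v = "axis k 1 \<bullet> (W *v axis k 1)"
  define O' where "O' = U \<inter> {x. grad x \<bullet> ?e \<noteq> 0} \<inter> {x. q k k x \<noteq> 0}"
  have "open O'" unfolding O'_def
    by (intro open_Int U(1) open_Collect_neq continuous_intros grad_continuous q_continuous)
  have x0O: "x0 \<in> O'" using x0 U by (simp add: O'_def)
  \<comment> \<open>Moves \<open>z\<close> along its line to level \<open>t\<close>. Continuity at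
    the fixed point \<open>x0\<close> keeps the image in the generic set \<open>O'\<close>.\<close>
  define \<xi> where "\<xi> z = z + lineparam k z t *\<^sub>R ?e" for z
  have gc: "isCont (\<lambda>z. grad z \<bullet> ?e) x0" and Tc: "isCont T x0"
    using grad_continuous[of UNIV] T_continuous[of UNIV]
    by (auto intro!: continuous_intros simp: continuous_on_eq_continuous_at)
  have "isCont (\<lambda>z. lineparam k z t) x0"
    unfolding lineparam_def using axis_W_pos[of k]
    by (intro continuous_parabola_inv[OF gc _ x0(2)] isCont_diff[OF continuous_const Tc]) simp
  then have "isCont \<xi> x0" unfolding \<xi>_def[abs_def] by (intro isCont_add isCont_scaleR continuous_ident continuous_const)
  moreover have "\<xi> x0 = x0" using x0(1) by (auto simp: \<xi>_def)
  ultimately have "(\<xi> \<longlongrightarrow> x0) (nhds x0)"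
    by (metis isCont_tendsto_nhds)
  then have 1: "\<forall>\<^sub>F z in nhds x0. \<xi> z \<in> O'"
    using \<open>open O'\<close> x0O by (rule topological_tendstoD)
  \<comment> \<open>A positive radicand guarantees that the line through \<open>z\<close> actually
    reaches level \<open>t\<close> at \<open>\<xi> z\<close>.\<close>
  have "isCont (\<lambda>z. (grad z \<bullet> ?e)\<^sup>2 + 2 * ?v * (t - T z)) x0"
    using gc Tc by (intro isCont_add isCont_mult isCont_power isCont_diff continuous_const)
  then have "((\<lambda>z. (grad z \<bullet> ?e)\<^sup>2 + 2 * ?v * (t - T z)) \<longlongrightarrow> (grad x0 \<bullet> ?e)\<^sup>2 + 2 * ?v * (t - T x0)) (nhds x0)"
    by (rule isCont_tendsto_nhds)
  then have 2: "\<forall>\<^sub>F z in nhds x0. 0 < (grad z \<bullet> ?e)\<^sup>2 + 2 * ?v * (t - T z)"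
    by (rule order_tendstoD) (use x0 in simp)
  have 3: "\<forall>\<^sub>F z in nhds x0. z \<in> O'" using \<open>open O'\<close> x0O by (rule eventually_nhds_in_open)
  obtain S where S: "open S" "x0 \<in> S" "\<And>z. z \<in> S \<Longrightarrow> z \<in> O' \<and> \<xi> z \<in> O' \<and>
      0 < (grad z \<bullet> ?e)\<^sup>2 + 2 * ?v * (t - T z)"
    using eventually_conj[OF 3 eventually_conj[OF 1 2]] unfolding eventually_nhds by blast
  have AEz: "AE z in lborel. \<forall>a b. a \<le> b \<longrightarrow> (\<forall>s\<in>{a..b}. z + s *\<^sub>R ?e \<in> U) \<longrightarrow>
      abs_cont_on_interval a b (\<lambda>s. \<tau> (z + s *\<^sub>R ?e) $ k $ k)"
    using U(3) by (intro ACL_AE_abs_cont_on_axis_lines) (auto simp: ACL1_def axis_in_Basis_iff)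
  then obtain z where z: "z \<in> S" and ac: "\<forall>a b. a \<le> b \<longrightarrow> (\<forall>s\<in>{a..b}. z + s *\<^sub>R ?e \<in> U) \<longrightarrow>
      abs_cont_on_interval a b (\<lambda>s. \<tau> (z + s *\<^sub>R ?e) $ k $ k)"
    using AE_lborel_ex_in_open[OF AEz S(1)] S(2) by auto
  define x1 where "x1 = \<xi> z"
  have x1: "x1 \<in> O'" using S(3)[OF z] by (simp add: x1_def)
  have Tx1: "T x1 = t"
    using T_lineparam[of z k t] S(3)[OF z] by (simp add: x1_def \<xi>_def O'_def)
  have wq: "grad x1 \<bullet> ?e \<noteq> 0" "q k k x1 \<noteq> 0" "x1 \<in> U" using x1 by (auto simp: O'_def)
  obtain \<eta> where \<eta>: "\<eta> > 0" "cball x1 \<eta> \<subseteq> U"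
    using U(1) wq(3) open_contains_cball by metis
  define s1 where "s1 = lineparam k z t"
  \<comment> \<open>\<open>x1\<close> lies on the line of \<open>z\<close>, at parameter
    \<open>s1\<close>; shifting the parameter recentres the absolutely continuous function at
    \<open>x1\<close>.\<close>
  have x1s: "x1 + s *\<^sub>R ?e = z + (s + s1) *\<^sub>R ?e" for s
    by (simp add: x1_def \<xi>_def s1_def algebra_simps)
  have "abs_cont_on_interval (- \<eta> + s1) (\<eta> + s1) (\<lambda>s. \<tau> (z + s *\<^sub>R ?e) $ k $ k)"
  proof (rule ac[rule_format])
    fix s assume "s \<in> {- \<eta> + s1..\<eta> + s1}"
    then have "x1 + (s - s1) *\<^sub>R ?e \<in> cball x1 \<eta>" by (auto simp: dist_norm norm_axis_1)
    then show "z + s *\<^sub>R ?e \<in> U" using \<eta>(2) x1s[of "s - s1"] by auto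
  qed (use \<eta> in simp)
  then have "abs_cont_on_interval (- \<eta>) \<eta> (\<lambda>s. \<tau> (x1 + s *\<^sub>R ?e) $ k $ k)"
    unfolding x1s by (rule abs_cont_on_interval_shift)
  then have "continuous_on {-\<eta>..\<eta>} (\<lambda>s. \<tau> (x1 + s *\<^sub>R ?e) $ k $ k)"
    by (rule abs_cont_imp_continuous_on)
  then have "isCont (\<lambda>s. \<tau> (x1 + s *\<^sub>R ?e) $ k $ k) 0"
    by (rule continuous_on_interior) (use \<eta> in simp)
  then have "isCont (\<lambda>s. \<Gamma> k (x1 + s *\<^sub>R ?e)) (lineparam k x1 (T x1))"
    using isCont_\<Gamma>_line[OF wq(2)] by simp
  moreover have "isCont (lineparam k x1) (T x1)"
    using DERIV_lineparam[OF wq(1)] DERIV_isCont by blast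
  ultimately have "isCont (\<lambda>t. \<Gamma> k (x1 + lineparam k x1 t *\<^sub>R ?e)) (T x1)"
    by (rule isCont_o2[rotated])
  then show ?thesis
    using isCont_cong[OF c_eq_\<Gamma>_lineparam[OF wq(1,2)]] by (simp add: Tx1)
qed

text \<open>Chain rule for \<open>\<Gamma>\<close> along the line composed with
  \<open>lineparam\<close>. Only the derivative at \<open>x\<close> itself enters, so, unlike in
  \<open>c_isCont\<close>, the argument stays on the line through the given point.\<close>

lemma c_differentiable:
  assumes w: "grad x \<bullet> axis k 1 \<noteq> 0" and q: "q k k x \<noteq> 0"
    and \<tau>: "(\<lambda>s. \<tau> (x + s *\<^sub>R axis k 1) $ k $ k) differentiable (at 0)"
  obtains c' where "(c has_real_derivative c') (at (T x))"
proof -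
  let ?e = "axis k 1 :: real^'n"
  have Tx: "0 < T x" by (rule q_nonzero_imp_T_pos[OF q])
  have "((\<lambda>t. \<phi> t / \<phi>1 t) has_real_derivative 1 - \<delta> - c (T x)) (at (T (x + 0 *\<^sub>R ?e)))"
    using \<phi>_ratio_deriv[of "T x"] Tx by (simp add: at_within_nonneg)
  from DERIV_chain2[OF this T_line_deriv]
  obtain \<psi>' where \<psi>': "((\<lambda>s. \<phi> (T (x + s *\<^sub>R ?e)) / \<phi>1 (T (x + s *\<^sub>R ?e))) has_real_derivative \<psi>') (at 0)"
    by blast
  have \<psi>_diff: "(\<lambda>s. \<phi> (T (x + s *\<^sub>R ?e)) / \<phi>1 (T (x + s *\<^sub>R ?e))) differentiable (at 0)"
    using \<psi>' unfolding real_differentiable_def by blast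
  have q_diff: "(\<lambda>s. q k k (x + s *\<^sub>R ?e)) differentiable (at 0)"
    using q_line_deriv unfolding real_differentiable_def by blast
  have "(\<lambda>s. \<Gamma> k (x + s *\<^sub>R ?e)) differentiable (at 0)"
    unfolding \<Gamma>_def
    by (intro differentiable_divide[OF _ q_diff] differentiable_add differentiable_mult[OF \<tau>]
        differentiable_mult[OF differentiable_mult[OF _ \<psi>_diff]] differentiable_const) (use q in simp)
  then obtain \<Gamma>' where "((\<lambda>s. \<Gamma> k (x + s *\<^sub>R ?e)) has_real_derivative \<Gamma>') (at (lineparam k x (T x)))"
    by (auto simp: real_differentiable_def)
  moreover obtain R' where "(lineparam k x has_real_derivative R') (at (T x))"
    using DERIV_lineparam[OF w] by blast
  ultimately have "((\<lambda>t. \<Gamma> k (x + lineparam k x t *\<^sub>R ?e)) has_real_derivative \<Gamma>' * R') (at (T x))"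
    by (rule DERIV_chain2)
  then have "(c has_real_derivative \<Gamma>' * R') (at (T x))"
    by (subst DERIV_cong_ev[OF refl c_eq_\<Gamma>_lineparam[OF w q] refl])
  then show thesis by (rule that)
qed

end

section \<open>Local-to-global differentiability, and means of symmetric densities\<close>

lemma AE_differentiable_ACL1_loc:
  fixes f :: "'a::euclidean_space \<Rightarrow> real"
  assumes f: "f \<in> ACL1_loc UNIV" and e: "norm e = 1"
  shows "AE x in lebesgue. (\<lambda>s. f (x + s *\<^sub>R e)) differentiable (at 0)"
proof -
  \<comment> \<open>Each neighbourhood has its own exceptional null set; a countable subcover keeps
    their union null.\<close>
  define \<F> where "\<F> = {U. open U \<and> f \<in> ACL1 U}"
  have "\<Union>\<F> = UNIV" using f by (fastforce simp: ACL1_loc_def \<F>_def)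
  moreover obtain \<F>' where \<F>': "\<F>' \<subseteq> \<F>" "countable \<F>'" "\<Union>\<F>' = \<Union>\<F>"
    using Lindelof[of \<F>] by (auto simp: \<F>_def)
  ultimately have cover: "\<Union>\<F>' = UNIV" by simp
  have "AE x in lebesgue. x \<in> U \<longrightarrow> (\<lambda>s. f (x + s *\<^sub>R e)) differentiable (at 0)" if "U \<in> \<F>'" for U
    using that \<F>'(1) e by (auto simp: \<F>_def ACL1_def)
  then have "AE x in lebesgue. \<forall>U\<in>\<F>'. x \<in> U \<longrightarrow> (\<lambda>s. f (x + s *\<^sub>R e)) differentiable (at 0)"
    unfolding AE_ball_countable[OF \<F>'(2)] by blast
  then show ?thesis by eventually_elim (use cover in blast)
qed

lemma set_integrable_lebesgue_compact:
  fixes f :: "'a::euclidean_space \<Rightarrow> real"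
  assumes "compact S" "continuous_on S f"
  shows "set_integrable lebesgue S f"
proof -
  have "integrable lborel (\<lambda>x. indicator S x *\<^sub>R f x)"
    by (rule borel_integrable_compact[OF assms])
  then show ?thesis
    unfolding set_integrable_def by (subst integrable_completion) auto
qed

text \<open>The reflection at \<open>\<nu>\<close> preserves Lebesgue measure and \<open>p\<close>,
  so the integral equals \<open>2 *\<^sub>R \<nu>\<close> minus itself, the total mass being
  1.\<close>

lemma integral_symmetric_mean:
  fixes p :: "'a::euclidean_space \<Rightarrow> real"
  assumes sym: "\<And>x. p (2 *\<^sub>R \<nu> - x) = p x"
    and p: "has_bochner_integral lborel p 1" and m: "integrable lborel (\<lambda>x. p x *\<^sub>R x)"
  shows "(\<integral>x. p x *\<^sub>R x \<partial>lborel) = \<nu>"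
proof -
  let ?r = "\<lambda>x. 2 *\<^sub>R \<nu> + (-1) *\<^sub>R x"
  have l: "lborel = distr lborel borel ?r"
    using lborel_affine[of "-1" "2 *\<^sub>R \<nu>"] by (simp add: density_1)
  have "(\<integral>x. p x *\<^sub>R x \<partial>lborel) = (\<integral>x. p x *\<^sub>R x \<partial>(distr lborel borel ?r))"
    using l by simp
  also have "\<dots> = (\<integral>x. p (?r x) *\<^sub>R ?r x \<partial>lborel)"
    by (rule integral_distr) (use borel_measurable_integrable[OF m] in auto)
  also have "\<dots> = (\<integral>x. p x *\<^sub>R (2 *\<^sub>R \<nu>) - p x *\<^sub>R x \<partial>lborel)"
    using sym by (simp add: scaleR_diff_right)
  also have "\<dots> = 2 *\<^sub>R \<nu> - (\<integral>x. p x *\<^sub>R x \<partial>lborel)"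
    using p m by (subst Bochner_Integration.integral_diff) (auto simp: has_bochner_integral_iff)
  finally have "2 *\<^sub>R (\<integral>x. p x *\<^sub>R x \<partial>lborel) = 2 *\<^sub>R \<nu>"
    by (simp add: scaleR_2 algebra_simps)
  then show ?thesis by simp
qed

section \<open>Regularity of the kernel times the density\<close>

context elliptical begin

lemma T_reflect: "T (2 *\<^sub>R \<nu> - x) = T x"
proof -
  have "2 *\<^sub>R \<nu> - x - \<nu> = (-1) *\<^sub>R (x - \<nu>)" by (simp add: scaleR_2)
  then show ?thesis unfolding half_quad_def
    by (simp only: matrix_vector_mult_scaleR inner_scaleR_left inner_scaleR_right)
qed

text \<open>\<open>\<phi>\<close> is differentiable relative to the half-line only, hence
  one-sidedly at 0. As \<open>T\<close> takes values in the half-line, the chain rule within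
  \<open>range T\<close> still gives a full derivative, also at \<open>\<nu>\<close>.\<close>

lemma density_has_derivative:
  "((\<lambda>x. \<kappa> * \<phi> (T x)) has_derivative (\<lambda>h. ((\<kappa> * \<phi>1 (T x)) *\<^sub>R grad x) \<bullet> h)) (at x)"
proof -
  have "(\<phi> has_derivative (*) (\<phi>1 (T x))) (at (T x) within range T)"
    by (rule has_derivative_subset[OF \<phi>_deriv[OF T_nonneg, unfolded has_field_derivative_def]])
      (auto simp: T_nonneg)
  from has_derivative_in_compose[OF T_has_derivative this]
  show ?thesis by (auto intro!: derivative_eq_intros simp: mult.assoc)
qed

lemma \<phi>1_T_continuous: "continuous_on A (\<lambda>x. \<phi>1 (T x))"
proof -
  have "continuous_on {0..} \<phi>1" using \<phi>1_deriv by (intro DERIV_continuous_on) auto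
  then show ?thesis
    by (rule continuous_on_compose2[OF _ T_continuous]) (use T_nonneg in auto)
qed

lemma \<phi>_ratio_T_continuous: "continuous_on A (\<lambda>x. \<phi> (T x) / \<phi>1 (T x))"
proof -
  have "continuous_on {0..} (\<lambda>t. \<phi> t / \<phi>1 t)"
    using \<phi>_ratio_deriv by (intro DERIV_continuous_on) auto
  then show ?thesis
    by (rule continuous_on_compose2[OF _ T_continuous]) (use T_nonneg in auto)
qed

context
  assumes \<tau>_ACL1_loc: "\<And>i j. (\<lambda>x. \<tau> x $ i $ j) \<in> ACL1_loc UNIV"
begin

text \<open>Continuity of \<open>c\<close> on the open half-line comes from one diagonal entry and
  settles all entries. The point \<open>\<nu>\<close>, where \<open>T\<close> is 0, stays
  excluded.\<close>

lemma \<tau>_continuous: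
  assumes "\<nu> \<notin> A"
  shows "continuous_on A (\<lambda>x. \<tau> x $ i $ j)"
proof -
  have "continuous_on {0<..} c"
    using c_isCont[OF \<tau>_ACL1_loc] by (auto intro: continuous_at_imp_continuous_on)
  then have cT: "continuous_on A (\<lambda>x. c (T x))"
    by (rule continuous_on_compose2[OF _ T_continuous]) (use assms in \<open>auto intro!: T_pos\<close>)
  show ?thesis
    unfolding tau_eq[OF T_nonneg] using card \<delta>
    by (intro continuous_on_divide continuous_on_add continuous_on_mult continuous_on_const
        \<phi>_ratio_T_continuous cT q_continuous) auto
qed

text \<open>Off \<open>\<nu>\<close> a small closed ball avoids \<open>\<nu>\<close>, and continuity
  on it suffices. At \<open>\<nu>\<close> no bound on \<open>c\<close> is at hand, and the box
  estimate \<open>ACL1_integrable_on_cbox\<close> takes over.\<close>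

lemma \<tau>_locally_integrable:
  obtains V where "open V" "bounded V" "x \<in> V" "(\<lambda>x. \<tau> x $ i $ j) \<in> ACL1 V"
    "set_integrable lebesgue V (\<lambda>x. \<tau> x $ i $ j)"
proof -
  let ?g = "\<lambda>x. \<tau> x $ i $ j"
  obtain U where U: "open U" "x \<in> U" "?g \<in> ACL1 U"
    using \<tau>_ACL1_loc[of i j] unfolding ACL1_loc_def by blast
  show thesis
  proof (cases "x = \<nu>")
    case False
    then have "open (U - {\<nu>})" "x \<in> U - {\<nu>}" using U by auto
    then obtain r where r: "r > 0" "cball x r \<subseteq> U - {\<nu>}"
      using open_contains_cball by metis
    have "set_integrable lebesgue (cball x r) ?g"
      by (rule set_integrable_lebesgue_compact[OF compact_cball \<tau>_continuous]) (use r in auto)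
    then have "set_integrable lebesgue (ball x r) ?g"
      by (rule set_integrable_subset) auto
    moreover have "?g \<in> ACL1 (ball x r)"
      by (rule ACL1_subset[OF U(3) subset_trans[OF ball_subset_cball]]) (use r(2) in \<open>blast, simp\<close>)
    ultimately show thesis using that[of "ball x r"] r by simp
  next
    case True
    obtain r where r: "r > 0" "cball \<nu> r \<subseteq> U"
      using U True open_contains_cball by metis
    obtain l u where lu: "\<nu> \<in> box l u" "box l u \<subseteq> ball \<nu> r"
      using rational_boxes[OF r(1)] by metis
    have "closure (box l u) = cbox l u" using lu(1) by (intro closure_box) auto
    then have sub: "cbox l u \<subseteq> U"
      using closure_mono[OF lu(2)] r by auto
    define e :: "real^'n" where "e = axis undefined 1"
    have e: "e \<in> Basis" by (simp add: e_def axis_in_Basis_iff)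
    \<comment> \<open>The upper face in an arbitrary coordinate direction. As \<open>\<nu>\<close>
      lies in the open box it is not on this compact face, where the kernel entry is therefore
      bounded.\<close>
    define F where "F = cbox l u \<inter> {x. e \<bullet> x = e \<bullet> u}"
    have "compact F" unfolding F_def by (intro compact_Int_closed compact_cbox closed_hyperplane)
    moreover have "\<nu> \<notin> F"
      using lu(1) e by (auto simp: F_def mem_box inner_commute dest!: bspec[where x=e])
    ultimately have "bounded (?g ` F)"
      by (intro compact_imp_bounded compact_continuous_image \<tau>_continuous)
    then obtain M where M: "\<And>x. x \<in> F \<Longrightarrow> \<bar>?g x\<bar> \<le> M"
      unfolding bounded_iff by auto
    have "set_integrable lebesgue (cbox l u) ?g"
      by (rule ACL1_integrable_on_cbox[OF U(3) sub U(1) e M]) (auto simp: F_def inner_commute)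
    then have "set_integrable lebesgue (box l u) ?g"
      by (rule set_integrable_subset) (auto simp: box_subset_cbox)
    moreover have "?g \<in> ACL1 (box l u)"
      by (rule ACL1_subset[OF U(3) subset_trans[OF box_subset_cbox sub]]) simp
    ultimately show thesis using that[OF open_box bounded_box] lu True by simp
  qed
qed

lemma \<tau>_density_ACL1_loc: "(\<lambda>x. \<tau> x $ i $ j * (\<kappa> * \<phi> (T x))) \<in> ACL1_loc UNIV"
  unfolding ACL1_loc_def
proof (intro CollectI ballI)
  fix x :: "real^'n"
  obtain V where V: "open V" "bounded V" "x \<in> V" "(\<lambda>x. \<tau> x $ i $ j) \<in> ACL1 V"
    "set_integrable lebesgue V (\<lambda>x. \<tau> x $ i $ j)"
    by (rule \<tau>_locally_integrable)
  have "(\<lambda>x. \<tau> x $ i $ j * (\<kappa> * \<phi> (T x))) \<in> ACL1 V"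
    by (rule ACL1_mult_smooth[OF V(4,5,1,2) density_has_derivative])
      (intro continuous_intros \<phi>1_T_continuous grad_continuous)
  then show "\<exists>U. open U \<and> x \<in> U \<and> U \<subseteq> UNIV \<and> (\<lambda>x. \<tau> x $ i $ j * (\<kappa> * \<phi> (T x))) \<in> ACL1 U"
    using V by blast
qed

end

section \<open>The divergence identity\<close>

lemma grad_nth: "grad x \<bullet> axis j 1 = grad x $ j"
  by (simp add: inner_axis)

lemma \<Sigma>_grad_nth: "(\<Sum>j\<in>UNIV. \<Sigma> $ i $ j * grad x $ j) = (x - \<nu>) $ i"
proof -
  have "(\<Sigma> *v grad x) $ i = (x - \<nu>) $ i" by (simp only: grad_def \<Sigma>_W)
  then show ?thesis by (simp add: matrix_vector_mult_def)
qed

text \<open>The two parts of \<open>q\<close> cancel because \<open>\<Sigma> *v grad x\<close> is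
  \<open>x - \<nu>\<close> and the inner product of \<open>x - \<nu>\<close> with
  \<open>grad x\<close> is \<open>2 * T x\<close>. In the divergence this removes the term that
  contains the derivative of \<open>c\<close>.\<close>

lemma q_grad_sum: "(\<Sum>j\<in>UNIV. q i j x * grad x $ j) = 0"
proof -
  have "(\<Sum>j\<in>UNIV. q i j x * grad x $ j)
      = 2 * T x * (\<Sum>j\<in>UNIV. \<Sigma> $ i $ j * grad x $ j)
        - (x - \<nu>) $ i * (\<Sum>j\<in>UNIV. (x - \<nu>) $ j * grad x $ j)"
    by (simp only: q_def left_diff_distrib sum_subtractf sum_distrib_left mult.assoc)
  also have "(\<Sum>j\<in>UNIV. (x - \<nu>) $ j * grad x $ j) = 2 * T x"
    by (simp add: T_eq inner_vec_def)
  finally show ?thesis by (simp only: \<Sigma>_grad_nth mult.commute cancel_comm_monoid_add_class.diff_cancel)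
qed

lemma T_line_chain:
  assumes "(f has_real_derivative f') (at (T x))"
  shows "((\<lambda>s. f (T (x + s *\<^sub>R e))) has_real_derivative f' * (grad x \<bullet> e)) (at 0)"
proof -
  have "(f has_real_derivative f') (at (T (x + 0 *\<^sub>R e)))" using assms by simp
  from DERIV_chain2[OF this T_line_deriv] show ?thesis .
qed

text \<open>Up to constants, row \<open>i\<close> of the kernel times the density is
  \<open>- N * \<phi>\<^sup>2 / \<phi>1\<close> times row \<open>i\<close> of
  \<open>\<Sigma>\<close> plus \<open>c * \<phi>\<close> times row \<open>i\<close> of
  \<open>q\<close>. Every surviving term of the divergence is a multiple of
  \<open>(x - \<nu>) $ i\<close>, and \<open>\<phi>2\<close> drops out of the total factor.\<close>

lemma divergence_\<tau>_density:
  assumes T: "0 < T x" and c': "(c has_real_derivative c') (at (T x))"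
  shows "(\<Sum>j\<in>UNIV. dir_deriv (axis j 1) (\<lambda>y. \<tau> y $ i $ j * (\<kappa> * \<phi> (T y))) x)
    = - (\<kappa> * \<phi> (T x)) * (x - \<nu>) $ i"
proof -
  define t where "t = T x"
  define N where "N = real CARD('n) - 1"
  define K where "K = (2 - \<delta>) * N"
  have NK: "N \<noteq> 0" "K \<noteq> 0" using card \<delta> by (auto simp: N_def K_def)
  have t0: "0 < t" "0 \<le> t" using T by (auto simp: t_def)
  have nz: "\<phi> t \<noteq> 0" "\<phi>1 t \<noteq> 0" using \<phi>_pos[OF t0(2)] \<phi>1_nz[OF t0(2)] by auto
  \<comment> \<open>\<open>G'\<close> and \<open>F'\<close> are the derivatives at \<open>t\<close>
    of \<open>\<phi>\<^sup>2 / \<phi>1\<close> and of \<open>c * \<phi>\<close>.\<close>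
  define G' where "G' = 2 * \<phi> t - (\<phi> t)\<^sup>2 * \<phi>2 t / (\<phi>1 t)\<^sup>2"
  define F' where "F' = c' * \<phi> t + c t * \<phi>1 t"
  have d\<phi>: "(\<phi> has_real_derivative \<phi>1 t) (at t)" and d\<phi>1: "(\<phi>1 has_real_derivative \<phi>2 t) (at t)"
    using \<phi>_deriv[OF t0(2)] \<phi>1_deriv[OF t0(2)] by (simp_all add: at_within_nonneg[OF t0(1)])
  have "((\<lambda>s. \<phi> s * \<phi> s / \<phi>1 s) has_real_derivative G') (at t)"
    using nz unfolding G'_def
    by (auto intro!: derivative_eq_intros d\<phi> d\<phi>1 simp: field_simps power2_eq_square)
  then have dG: "((\<lambda>s. \<phi> (T (x + s *\<^sub>R e)) * \<phi> (T (x + s *\<^sub>R e)) / \<phi>1 (T (x + s *\<^sub>R e)))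
      has_real_derivative G' * (grad x \<bullet> e)) (at 0)" for e
    unfolding t_def by (rule T_line_chain)
  have "((\<lambda>s. c s * \<phi> s) has_real_derivative F') (at t)"
    using DERIV_mult[OF c' d\<phi>[unfolded t_def]] by (simp add: F'_def t_def algebra_simps)
  then have dF: "((\<lambda>s. c (T (x + s *\<^sub>R e)) * \<phi> (T (x + s *\<^sub>R e)))
      has_real_derivative F' * (grad x \<bullet> e)) (at 0)" for e
    unfolding t_def by (rule T_line_chain)
  have eq: "\<tau> y $ i $ j * (\<kappa> * \<phi> (T y)) = \<kappa> / K *
      (- N * \<Sigma> $ i $ j * (\<phi> (T y) * \<phi> (T y) / \<phi>1 (T y)) + (c (T y) * \<phi> (T y)) * q i j y)" for y j
    unfolding tau_eq[OF T_nonneg] N_def[symmetric] K_def[symmetric]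
    using NK(2) \<phi>1_nz[OF T_nonneg, of y] by (simp add: field_simps)
  have "dir_deriv (axis j 1) (\<lambda>y. \<tau> y $ i $ j * (\<kappa> * \<phi> (T y))) x
      = \<kappa> / K * (- N * \<Sigma> $ i $ j * (G' * grad x $ j) + (F' * grad x $ j * q i j x
          + (2 * grad x $ j * \<Sigma> $ i $ j - (of_bool (i = j) * (x - \<nu>) $ j + (x - \<nu>) $ i)) * (c t * \<phi> t)))" for j
    unfolding dir_deriv_def eq
    by (rule DERIV_imp_deriv, rule DERIV_cong,
        rule DERIV_cmult[OF DERIV_add[OF DERIV_cmult[OF dG] DERIV_mult[OF dF q_line_deriv]]])
      (simp add: grad_nth t_def)
  then have "(\<Sum>j\<in>UNIV. dir_deriv (axis j 1) (\<lambda>y. \<tau> y $ i $ j * (\<kappa> * \<phi> (T y))) x)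
      = (\<Sum>j\<in>UNIV. \<kappa> / K * (- N * \<Sigma> $ i $ j * (G' * grad x $ j) + (F' * grad x $ j * q i j x
          + (2 * grad x $ j * \<Sigma> $ i $ j - (of_bool (i = j) * (x - \<nu>) $ j + (x - \<nu>) $ i)) * (c t * \<phi> t))))"
    by simp
  also have "\<dots>
      = \<kappa> / K * (- N * G' * (\<Sum>j\<in>UNIV. \<Sigma> $ i $ j * grad x $ j) + F' * (\<Sum>j\<in>UNIV. q i j x * grad x $ j)
          + (2 * (\<Sum>j\<in>UNIV. \<Sigma> $ i $ j * grad x $ j)
             - ((\<Sum>j\<in>UNIV. of_bool (i = j) * (x - \<nu>) $ j) + (\<Sum>j\<in>(UNIV::'n set). (x - \<nu>) $ i))) * (c t * \<phi> t))"
    unfolding sum_distrib_left sum_distrib_right sum.distrib[symmetric] sum_subtractf[symmetric]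
    by (intro sum.cong refl) (simp add: algebra_simps)
  also have "(\<Sum>j\<in>UNIV. of_bool (i = j) * (x - \<nu>) $ j) = (x - \<nu>) $ i"
    by (simp add: of_bool_def if_distrib[where f="\<lambda>z. z * _"] cong: if_cong)
  also have "(\<Sum>j\<in>(UNIV::'n set). (x - \<nu>) $ i) = (N + 1) * (x - \<nu>) $ i"
    by (simp add: N_def)
  \<comment> \<open>The divergence of row \<open>i\<close> of \<open>q\<close> is
    \<open>2 - 1 - (N + 1) = - N\<close> times \<open>(x - \<nu>) $ i\<close>, so the factor
    \<open>N\<close> comes out of both remaining terms.\<close>
  also have "\<kappa> / K * (- N * G' * (\<Sum>j\<in>UNIV. \<Sigma> $ i $ j * grad x $ j) + F' * (\<Sum>j\<in>UNIV. q i j x * grad x $ j)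
          + (2 * (\<Sum>j\<in>UNIV. \<Sigma> $ i $ j * grad x $ j)
             - ((x - \<nu>) $ i + (N + 1) * (x - \<nu>) $ i)) * (c t * \<phi> t))
      = - (\<kappa> * (N * (G' + c t * \<phi> t)) / K) * (x - \<nu>) $ i"
    unfolding \<Sigma>_grad_nth q_grad_sum by (simp add: algebra_simps add_divide_distrib diff_divide_distrib)
  \<comment> \<open>The \<open>\<phi>2\<close> terms of \<open>G'\<close> and of
    \<open>c t * \<phi> t\<close> cancel; the remaining factor \<open>2 - \<delta>\<close> and
    \<open>N\<close> are absorbed by \<open>K\<close>.\<close>
  also have "G' + c t * \<phi> t = (2 - \<delta>) * \<phi> t"
    using nz by (simp add: G'_def c_def power2_eq_square field_simps)
  also have "\<kappa> * (N * ((2 - \<delta>) * \<phi> t)) / K = \<kappa> * \<phi> t"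
    using NK by (simp add: K_def)
  finally show ?thesis by (simp add: t_def)
qed

text \<open>Three null sets are discarded: tangency to the axis, vanishing of \<open>q k k\<close>,
  and non-differentiability of the diagonal entry along the axis. Off the second one,
  \<open>x\<close> differs from \<open>\<nu>\<close> and \<open>T x\<close> is positive.\<close>

lemma AE_c_differentiable:
  assumes "(\<lambda>x. \<tau> x $ k $ k) \<in> ACL1_loc UNIV"
  shows "AE x in lebesgue. 0 < T x \<and> (\<exists>c'. (c has_real_derivative c') (at (T x)))"
proof -
  have "AE x in lebesgue. (\<lambda>s. \<tau> (x + s *\<^sub>R axis k 1) $ k $ k) differentiable (at 0)"
    by (rule AE_differentiable_ACL1_loc[OF assms]) (simp add: norm_axis_1)
  with AE_lebesgue_not_in_negligible[OF grad_zero_negligible[of k]]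
    AE_lebesgue_not_in_negligible[OF q_zero_negligible[of k]]
  show ?thesis
  proof eventually_elim
    case (elim x)
    then obtain c' where "(c has_real_derivative c') (at (T x))"
      using c_differentiable[of x k] by auto
    then show ?case using elim q_nonzero_imp_T_pos by auto
  qed
qed

end

section \<open>Verification of the Stein kernel conditions\<close>

theorem proposition4p16:
  fixes \<nu> :: "real^'n" and \<Sigma> :: "real^'n^'n"
    and \<phi> \<phi>1 \<phi>2 :: "real \<Rightarrow> real" and \<delta> :: real
  assumes "CARD('n) \<ge> 2"
    and "sym_pos_def \<Sigma>"
    and "\<And>t. t \<ge> 0 \<Longrightarrow> \<phi> t > 0"
    and "\<And>t. t \<ge> 0 \<Longrightarrow> (\<phi> has_real_derivative \<phi>1 t) (at t within {0..})"
    and "\<And>t. t \<ge> 0 \<Longrightarrow> (\<phi>1 has_real_derivative \<phi>2 t) (at t within {0..})"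
    and "\<And>t. t \<ge> 0 \<Longrightarrow> \<phi>1 t \<noteq> 0"
    and "is_pdf (elliptical_pdf \<nu> \<Sigma> \<phi>)"
    and "has_finite_mean (elliptical_pdf \<nu> \<Sigma> \<phi>)"
    and "\<delta> \<noteq> 2"
    and "\<And>i j. (\<lambda>x. tau_delta \<nu> \<Sigma> \<phi> \<phi>1 \<phi>2 \<delta> x $ i $ j) \<in> ACL1_loc UNIV"
  shows "is_stein_kernel (elliptical_pdf \<nu> \<Sigma> \<phi>) (tau_delta \<nu> \<Sigma> \<phi> \<phi>1 \<phi>2 \<delta>)"
proof -
  interpret elliptical \<nu> \<Sigma> \<phi> \<phi>1 \<phi>2 \<delta>
    using assms(1-6,9) by (intro elliptical.intro)
  define p where "p = elliptical_pdf \<nu> \<Sigma> \<phi>"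
  define Z where "Z = (\<integral>y. elliptical_unnormalized \<nu> \<Sigma> \<phi> y \<partial>lborel)"
  define \<kappa> where "\<kappa> = 1 / Z * det \<Sigma> powr (-1/2)"
  have p_eq: "p = (\<lambda>x. \<kappa> * \<phi> (T x))"
    by (auto simp: p_def elliptical_pdf_def elliptical_unnormalized_def Z_def \<kappa>_def)
  have pdf: "has_bochner_integral lborel p 1" "\<And>x. 0 \<le> p x"
    using assms(7) by (auto simp: p_def is_pdf_def)
  \<comment> \<open>Total mass 1 rules out the default value 0 of the normalizing factor, which a
    divergent integral would produce.\<close>
  have "\<kappa> \<noteq> 0"
  proof
    assume "\<kappa> = 0"
    then have "p = (\<lambda>_. 0)" by (simp add: p_eq)
    then show False using pdf(1) by (simp add: has_bochner_integral_iff)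
  qed
  moreover have "0 \<le> \<kappa>"
    using pdf(2)[of \<nu>] \<phi>_pos[OF T_nonneg, of \<nu>] by (simp add: p_eq zero_le_mult_iff)
  ultimately have p_pos: "p x > 0" for x
    using \<phi>_pos[OF T_nonneg, of x] by (simp add: p_eq)
  then have supp: "pdf_support p = UNIV" by (simp add: pdf_support_def)
  \<comment> \<open>\<open>T\<close> is invariant under reflection at \<open>\<nu>\<close>, hence so
    is the density.\<close>
  have mean: "pdf_mean p = \<nu>"
    unfolding pdf_mean_def
    by (rule integral_symmetric_mean[OF _ pdf(1)])
      (use assms(8) in \<open>simp_all add: p_eq T_reflect has_finite_mean_def p_def[symmetric]\<close>)
  \<comment> \<open>One diagonal entry, of arbitrary index, supplies differentiability of
    \<open>c\<close> at \<open>T x\<close> for almost every \<open>x\<close>; this serves all rows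
    \<open>i\<close> at once.\<close>
  have "AE x in lebesgue. \<forall>i. 1 / p x * (\<Sum>j\<in>UNIV. dir_deriv (axis j 1) (\<lambda>y. \<tau> y $ i $ j * p y) x) = \<nu> $ i - x $ i"
    using AE_c_differentiable[OF assms(10)[of undefined undefined]]
  proof eventually_elim
    case (elim x)
    then obtain c' where c': "0 < T x" "(c has_real_derivative c') (at (T x))" by blast
    have "(\<Sum>j\<in>UNIV. dir_deriv (axis j 1) (\<lambda>y. \<tau> y $ i $ j * p y) x) = - p x * (x - \<nu>) $ i" for i
      unfolding p_eq by (rule divergence_\<tau>_density[OF c'])
    then show ?case using p_pos[of x] by (simp add: field_simps)
  qed
  then show ?thesis
    unfolding is_stein_kernel_def p_def[symmetric] supp mean
    using assms(7,8) \<tau>_density_ACL1_loc[OF assms(10), of _ _ \<kappa>]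
    by (auto simp: p_def[symmetric] p_eq)
qed

end
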